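(* (i) Let $ABC$ be a non-isosceles triangle, labelled so that its side lengths $a=|BC|$, $b=|AC|$, $c=|AB|$ satisfy $a<b<c$. Then $ABC$ has at most $3$ minimum area isosceles containers: every minimum area isosceles container for $ABC$ is one of the triangles $AB'C$, $ABC'$, $AB_1C$. In particular, every minimum area isosceles container for $ABC$ is a special container of the first or the second kind associated with $ABC$. (ii) There is a unique triangle $T^*$, up to similarity, which has precisely $3$ different minimum area isosceles containers. Its angles are $\alpha^*$, $2\alpha^*$, and $180^{\circ}-3\alpha^*$, where $\alpha^*\approx 41.831452^{\circ}$ is the unique solution of $\sin(\alpha)\sin(2\alpha)-\sin^2(3\alpha)=0$ in the interval $[36^{\circ},45^{\circ}]$.
   Context: Triangles are non-degenerate closed triangular regions in the plane. An isosceles triangle is one with at least two sides of equal length. An isosceles container for a triangle $T$ is an isosceles triangle $T'$ with $T\subseteq T'$; it is a minimum area isosceles container if its area is at most that of every isosceles container for $T$. $\vec{XY}$ denotes the ray starting at $X$ and passing through $Y$. Let $ABC$ be a triangle with $a=|BC|<b=|AC|<c=|AB|$. Special containers of the first kind associated with $ABC$: the isosceles triangles $AB'C$, $ABC'$, $ABC''$, where $B'$ is the point on the ray $\vec{CB}$ with $|B'C|=|AC|=b$; $C'$ is the point on the ray $\vec{AC}$ with $|AC'|=c$; $C''$ is the point on the ray $\vec{BC}$ with $|BC''|=c$. Special containers of the second kind associated with $ABC$: the isosceles triangles $AB_1C$, $ABC_1$, $ABC_2$, where $B_1\ne A$ is the point on the ray $\vec{AB}$ with $|B_1C|=|AC|=b$;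 $C_1\neq A$ is the point on the ray $\vec{AC}$ with $|BC_1|=|AB|=c$; $C_2\ne B$ is the point on the ray $\vec{BC}$ with $|AC_2|=|AB|=c$.
   Formalization: The printed approximation 41.831452° is inaccurate in its last digits (the root is about 41.83162°); the formal statement asserts only that α* lies within 0.0002° of 41.831452°. *)

theory Defs
  imports "HOL-Analysis.Analysis"
begin

type_synonym point = "real^2"

definition is_triangle :: "point set \<Rightarrow> bool" where
  "is_triangle T \<longleftrightarrow> (\<exists>X Y Z. \<not> collinear {X, Y, Z} \<and> T = convex hull {X, Y, Z})"

definition isosceles_triangle :: "point set \<Rightarrow> bool" where
  "isosceles_triangle T \<longleftrightarrow>
     (\<exists>X Y Z. \<not> collinear {X, Y, Z} \<and> T = convex hull {X, Y, Z} \<and> dist X Y = dist X Z)"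

definition isosceles_container :: "point set \<Rightarrow> point set \<Rightarrow> bool" where
  "isosceles_container T T' \<longleftrightarrow> isosceles_triangle T' \<and> T \<subseteq> T'"

definition area :: "point set \<Rightarrow> real" where
  "area T = measure lebesgue T"

definition min_isosceles_container :: "point set \<Rightarrow> point set \<Rightarrow> bool" where
  "min_isosceles_container T T' \<longleftrightarrow>
     isosceles_container T T' \<and> (\<forall>T''. isosceles_container T T'' \<longrightarrow> area T' \<le> area T'')"

definition ray :: "point \<Rightarrow> point \<Rightarrow> point set" where
  "ray X Y = {X + t *\<^sub>R (Y - X) | t. 0 \<le> t}"

text \<open>
  The auxiliary points for a triangle \<open>A B C\<close>. The lemma
  \<open>special_points_ex1\<close> below shows that these descriptions are proper when
  \<open>A B C\<close> is non-degenerate with \<open>dist B C < dist A C < dist A B\<close>.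
\<close>

definition pt_B' :: "point \<Rightarrow> point \<Rightarrow> point \<Rightarrow> point" where
  "pt_B' A B C = (THE P. P \<in> ray C B \<and> dist P C = dist A C)"

definition pt_C' :: "point \<Rightarrow> point \<Rightarrow> point \<Rightarrow> point" where
  "pt_C' A B C = (THE P. P \<in> ray A C \<and> dist A P = dist A B)"

definition pt_C'' :: "point \<Rightarrow> point \<Rightarrow> point \<Rightarrow> point" where
  "pt_C'' A B C = (THE P. P \<in> ray B C \<and> dist B P = dist A B)"

definition pt_B1 :: "point \<Rightarrow> point \<Rightarrow> point \<Rightarrow> point" where
  "pt_B1 A B C = (THE P. P \<noteq> A \<and> P \<in> ray A B \<and> dist P C = dist A C)"

definition pt_C1 :: "point \<Rightarrow> point \<Rightarrow> point \<Rightarrow> point" where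
  "pt_C1 A B C = (THE P. P \<noteq> A \<and> P \<in> ray A C \<and> dist B P = dist A B)"

definition pt_C2 :: "point \<Rightarrow> point \<Rightarrow> point \<Rightarrow> point" where
  "pt_C2 A B C = (THE P. P \<noteq> B \<and> P \<in> ray B C \<and> dist A P = dist A B)"

definition special_first_kind :: "point \<Rightarrow> point \<Rightarrow> point \<Rightarrow> point set set" where
  "special_first_kind A B C =
     {convex hull {A, pt_B' A B C, C},
      convex hull {A, B, pt_C' A B C},
      convex hull {A, B, pt_C'' A B C}}"

definition special_second_kind :: "point \<Rightarrow> point \<Rightarrow> point \<Rightarrow> point set set" where
  "special_second_kind A B C =
     {convex hull {A, pt_B1 A B C, C},
      convex hull {A, B, pt_C1 A B C},
      convex hull {A, B, pt_C2 A B C}}"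

text \<open>The angle at \<open>Y\<close> of the triangle \<open>X Y Z\<close>, in radians.\<close>

definition angle_at :: "point \<Rightarrow> point \<Rightarrow> point \<Rightarrow> real" where
  "angle_at X Y Z = arccos (((X - Y) \<bullet> (Z - Y)) / (norm (X - Y) * norm (Z - Y)))"

definition has_angles :: "point set \<Rightarrow> real \<Rightarrow> real \<Rightarrow> real \<Rightarrow> bool" where
  "has_angles T \<alpha> \<beta> \<gamma> \<longleftrightarrow>
     (\<exists>X Y Z. \<not> collinear {X, Y, Z} \<and> T = convex hull {X, Y, Z} \<and>
        angle_at Y X Z = \<alpha> \<and> angle_at X Y Z = \<beta> \<and> angle_at X Z Y = \<gamma>)"

text \<open>Orientation-reversing similarities are allowed.\<close>

definition similar :: "point set \<Rightarrow> point set \<Rightarrow> bool" where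
  "similar S T \<longleftrightarrow>
     (\<exists>f r. 0 < r \<and> (\<forall>x y. dist (f x) (f y) = r * dist x y) \<and> f ` S = T)"

text \<open>
  The radian measure of \<open>x\<close> degrees. The literature value 41.831452 for the root of
  \<open>sin \<alpha> * sin (2 * \<alpha>) = (sin (3 * \<alpha>))\<^sup>2\<close> between 36 and 45 degrees is not correct
  to all printed digits: the root is 41.83161869... degrees. Hence the approximation is
  stated with tolerance 0.0002 degrees.
\<close>

definition degrees :: "real \<Rightarrow> real" where
  "degrees x = x * pi / 180"

lemma ex1_ray_start:
  fixes X Y :: point
  assumes "X \<noteq> Y" "0 \<le> d"
  shows "\<exists>!P. P \<in> ray X Y \<and> dist X P = d"
proof -
  have n: "norm (Y - X) > 0" using assms by simp
  show ?thesis
  proof (rule ex1I[of _ "X + (d / norm (Y - X)) *\<^sub>R (Y - X)"])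
    show "X + (d / norm (Y - X)) *\<^sub>R (Y - X) \<in> ray X Y \<and>
        dist X (X + (d / norm (Y - X)) *\<^sub>R (Y - X)) = d"
      using assms n by (auto simp: ray_def dist_norm)
  next
    fix P assume P: "P \<in> ray X Y \<and> dist X P = d"
    then obtain t where t: "P = X + t *\<^sub>R (Y - X)" "0 \<le> t" by (auto simp: ray_def)
    with P have "t * norm (Y - X) = d" by (simp add: dist_norm)
    with n have "t = d / norm (Y - X)" by (simp add: field_simps)
    with t show "P = X + (d / norm (Y - X)) *\<^sub>R (Y - X)" by simp
  qed
qed

text \<open>
  The circle around \<open>Z\<close> through \<open>X\<close> meets the ray from \<open>X\<close> through \<open>Y\<close> in exactly
  one further point: the angle at \<open>X\<close> is acute, since \<open>Y Z\<close> is not a longest side.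
\<close>

lemma ex1_ray_other:
  fixes X Y Z :: point
  assumes "X \<noteq> Y" and "dist Y Z < dist X Z \<or> dist Y Z < dist X Y"
  shows "\<exists>!P. P \<noteq> X \<and> P \<in> ray X Y \<and> dist P Z = dist X Z"
proof -
  define u v s where "u = Y - X" and "v = Z - X" and "s = 2 * (u \<bullet> v) / (u \<bullet> u)"
  have u: "u \<bullet> u > 0" using assms by (simp add: u_def)
  have yz: "dist Y Z = norm (u - v)" and xz: "dist X Z = norm v" and xy: "dist X Y = norm u"
    by (simp_all add: u_def v_def dist_norm norm_minus_commute)
  have e: "(norm (u - v))\<^sup>2 = u \<bullet> u - 2 * (u \<bullet> v) + v \<bullet> v"
    by (simp add: power2_norm_eq_inner inner_diff inner_commute)
  have "(norm (u - v))\<^sup>2 < (norm v)\<^sup>2 \<or> (norm (u - v))\<^sup>2 < (norm u)\<^sup>2"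
    using assms(2) unfolding yz xz xy by (auto intro: power_strict_mono)
  then have "u \<bullet> v > 0"
    unfolding e unfolding power2_norm_eq_inner
    using inner_ge_zero[of u] inner_ge_zero[of v] by linarith
  then have s: "s > 0" using u by (simp add: s_def)
  have d: "dist (X + t *\<^sub>R u) Z = dist X Z \<longleftrightarrow> t = 0 \<or> t = s" for t
  proof -
    have "dist (X + t *\<^sub>R u) Z = norm (t *\<^sub>R u - v)"
      by (simp add: u_def v_def dist_norm algebra_simps)
    then have "dist (X + t *\<^sub>R u) Z = dist X Z \<longleftrightarrow> (norm (t *\<^sub>R u - v))\<^sup>2 = (norm v)\<^sup>2"
      by (simp add: xz)
    also have "\<dots> \<longleftrightarrow> t * (t * (u \<bullet> u) - 2 * (u \<bullet> v)) = 0"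
      by (simp add: power2_norm_eq_inner inner_diff inner_commute algebra_simps)
    also have "\<dots> \<longleftrightarrow> t = 0 \<or> t = s"
      using u by (simp add: s_def field_simps)
    finally show ?thesis .
  qed
  show ?thesis
  proof (rule ex1I[of _ "X + s *\<^sub>R u"])
    show "X + s *\<^sub>R u \<noteq> X \<and> X + s *\<^sub>R u \<in> ray X Y \<and> dist (X + s *\<^sub>R u) Z = dist X Z"
      using s u d by (auto simp: ray_def u_def)
  next
    fix P assume P: "P \<noteq> X \<and> P \<in> ray X Y \<and> dist P Z = dist X Z"
    then obtain t where t: "P = X + t *\<^sub>R u" by (auto simp: ray_def u_def)
    with P d have "t = s" by auto
    with t show "P = X + s *\<^sub>R u" by simp
  qed
qed

lemma special_points_ex1:
  fixes A B C :: point
  assumes "\<not> collinear {A, B, C}" "dist B C < dist A C" "dist A C < dist A B"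
  shows "\<exists>!P. P \<in> ray C B \<and> dist P C = dist A C"
    and "\<exists>!P. P \<in> ray A C \<and> dist A P = dist A B"
    and "\<exists>!P. P \<in> ray B C \<and> dist B P = dist A B"
    and "\<exists>!P. P \<noteq> A \<and> P \<in> ray A B \<and> dist P C = dist A C"
    and "\<exists>!P. P \<noteq> A \<and> P \<in> ray A C \<and> dist B P = dist A B"
    and "\<exists>!P. P \<noteq> B \<and> P \<in> ray B C \<and> dist A P = dist A B"
proof -
  have ne: "A \<noteq> B" "A \<noteq> C" "B \<noteq> C"
    using assms(1) by (auto simp: insert_commute)
  show "\<exists>!P. P \<in> ray C B \<and> dist P C = dist A C"
    using ex1_ray_start[of C B "dist A C"] ne by (simp add: dist_commute)
  show "\<exists>!P. P \<in> ray A C \<and> dist A P = dist A B"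
    using ex1_ray_start[of A C "dist A B"] ne by simp
  show "\<exists>!P. P \<in> ray B C \<and> dist B P = dist A B"
    using ex1_ray_start[of B C "dist A B"] ne by simp
  show "\<exists>!P. P \<noteq> A \<and> P \<in> ray A B \<and> dist P C = dist A C"
    using ex1_ray_other[of A B C] ne assms by simp
  show "\<exists>!P. P \<noteq> A \<and> P \<in> ray A C \<and> dist B P = dist A B"
    using ex1_ray_other[of A C B] ne assms by (simp add: dist_commute)
  show "\<exists>!P. P \<noteq> B \<and> P \<in> ray B C \<and> dist A P = dist A B"
    using ex1_ray_other[of B C A] ne assms by (simp add: dist_commute)
qed

end

(*
  A minimum area container T' is rigid in two ways.  First, every side of T' meets T, since otherwise
  T' can be shrunk.  Second, some side of T' contains a whole side of T: if each side of T' met T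
  in one vertex only, turn T by a small angle +t or -t and circumscribe a homothetic copy of T' about
  it; the linear scale of that copy is a function F of the angle with F(t) + F(-t) = 2 cos t F(0),
  so one of the two copies is smaller than T'.

  Once a side of T lies on a side of T', the vertices of T have affine coordinates x, y, p, r in
  the frame of T', and the squared side lengths of T are polynomials in these and the cosine c of the
  apex angle.  Comparing the area of T' with the areas of the special containers gives polynomial
  inequalities, which hold only if T' is itself special.  For a < b < c only three special containers
  can be smallest; their areas are b/a, c/b and 1 + (b^2 - a^2)/c^2 times the area of T.  All three
  agree exactly if (a, b, c) is proportional to (1, B, B^2) with B^4 = B + 1.
*)
theory Submission
  imports Defs
begin

section \<open>Signed areas and barycentric coordinates\<close>

text \<open>The circumscribed homothetic copy keeps the shape of T', so it is isosceles whatever the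
  rotation; this settles the position of T inside T'. The remaining freedom, the apex angle, is
  settled by finitely many explicit rivals instead of calculus.

  Counting exactly 3 needs more than an analysis of given minima: a minimum must exist, an isosceles
  T must be excluded since it is its own only minimum container, and the three candidates must be
  distinct as sets.

  Equality of the first two ratios says b^2 = a c. With angles \<alpha>, 180 - 3 \<alpha>, 2
  \<alpha> opposite a, b, c (in degrees), the law of sines turns this into sin \<alpha> sin
  2\<alpha> = sin^2 3\<alpha>. Equality of the first and the third ratio becomes c^2 = a (a + b)
  after cancelling b - a, which is the condition that the angle opposite c is twice the angle
  opposite a. For a = 1, b = B the first condition gives c = B^2, the second B^4 = B + 1, and the
  law of cosines then simplifies to cos \<alpha> = B^2 / 2.\<close>

definition tri :: "point \<Rightarrow> point \<Rightarrow> point \<Rightarrow> real" where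
  "tri A B C = (B$1 - A$1) * (C$2 - A$2) - (B$2 - A$2) * (C$1 - A$1)"

lemma vec2_eq_iff: "(u::point) = v \<longleftrightarrow> u$1 = v$1 \<and> u$2 = v$2"
  by (simp add: vec_eq_iff forall_2)

lemma inner_vec2: "(u::point) \<bullet> v = u$1 * v$1 + u$2 * v$2"
  by (simp add: inner_vec_def sum_2)

lemma dist2_eq: "(dist (X::point) Y)\<^sup>2 = (X$1 - Y$1)\<^sup>2 + (X$2 - Y$2)\<^sup>2"
  by (simp only: dist_norm power2_norm_eq_inner inner_vec2) (simp add: power2_eq_square)

lemma area_triangle: "area (convex hull {A, B, C}) = \<bar>tri A B C\<bar> / 2"
proof -
  have "measure lebesgue (convex hull {A, B, C}) = measure lborel (convex hull {A, B, C})"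
    using finite_imp_compact_convex_hull[of "{A, B, C}"]
    by (intro measure_completion) (auto dest: compact_imp_closed)
  also have "\<dots> = \<bar>tri A B C\<bar> / 2"
    unfolding content_triangle tri_def by (simp add: abs_minus_commute mult.commute)
  finally show ?thesis by (simp add: area_def)
qed

text \<open>\<open>tri\<close> is twice the signed area and a polynomial in the coordinates, so
  \<open>tri A B C \<noteq> 0\<close> serves as the algebraic form of non-degeneracy. If the area
  vanishes, \<open>B\<close> coincides with its orthogonal projection onto the line through
  \<open>A\<close> and \<open>C\<close>, whose parameter is \<open>u\<close>.\<close>

lemma collinear_iff_tri: "collinear {A, B, C} \<longleftrightarrow> tri A B C = 0"
proof (cases "A = C")
  case False
  show ?thesis
  proof
    assume "collinear {A, B, C}"
    with False obtain u where "B = u *\<^sub>R A + (1 - u) *\<^sub>R C"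
      by (auto simp: collinear_3_expand)
    then have "B$1 = u * A$1 + (1 - u) * C$1" "B$2 = u * A$2 + (1 - u) * C$2" by simp_all
    then show "tri A B C = 0" unfolding tri_def by algebra
  next
    assume t: "tri A B C = 0"
    define n where "n = (A$1 - C$1)\<^sup>2 + (A$2 - C$2)\<^sup>2"
    have n: "n \<noteq> 0" using False by (auto simp: n_def vec2_eq_iff sum_power2_eq_zero_iff)
    define u where "u = ((B$1 - C$1) * (A$1 - C$1) + (B$2 - C$2) * (A$2 - C$2)) / n"
    have un: "u * n = (B$1 - C$1) * (A$1 - C$1) + (B$2 - C$2) * (A$2 - C$2)"
      using n by (simp add: u_def)
    have "n * (B$1 - C$1 - u * (A$1 - C$1)) = 0"
      using un t unfolding n_def tri_def by algebra
    moreover have "n * (B$2 - C$2 - u * (A$2 - C$2)) = 0"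
      using un t unfolding n_def tri_def by algebra
    ultimately have "B$1 - C$1 - u * (A$1 - C$1) = 0" "B$2 - C$2 - u * (A$2 - C$2) = 0"
      using n by simp_all
    then have "B = u *\<^sub>R A + (1 - u) *\<^sub>R C"
      by (simp add: vec2_eq_iff algebra_simps)
    then show "collinear {A, B, C}" by (auto simp: collinear_3_expand)
  qed
qed (simp add: tri_def insert_commute)

lemma tri_perm:
  "tri A C B = - tri A B C" "tri B A C = - tri A B C" "tri B C A = tri A B C"
  "tri C A B = tri A B C" "tri C B A = - tri A B C"
  by (simp_all add: tri_def algebra_simps)

text \<open>The barycentric coordinate of \<open>V\<close> at the vertex \<open>P\<close>; cyclic
  shifts of \<open>P Q R\<close> give the other two. In a non-degenerate triangle it vanishes
  exactly on the line through \<open>Q\<close> and \<open>R\<close>, which is how contact with a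
  side is expressed.\<close>

definition bary :: "point \<Rightarrow> point \<Rightarrow> point \<Rightarrow> point \<Rightarrow> real" where
  "bary P Q R V = tri V Q R / tri P Q R"

lemma bary_sum:
  assumes "tri P Q R \<noteq> 0"
  shows "bary P Q R V + bary Q R P V + bary R P Q V = 1"
proof -
  have "tri V Q R + tri V R P + tri V P Q = tri P Q R" by (simp add: tri_def algebra_simps)
  then show ?thesis using assms
    by (simp add: bary_def tri_perm(3)[of Q R P] tri_perm(3)[of P Q R] flip: add_divide_distrib)
qed

lemma bary_rep:
  assumes "tri P Q R \<noteq> 0"
  shows "V = bary P Q R V *\<^sub>R P + bary Q R P V *\<^sub>R Q + bary R P Q V *\<^sub>R R"
proof -
  have "tri P Q R *\<^sub>R V = tri V Q R *\<^sub>R P + tri V R P *\<^sub>R Q + tri V P Q *\<^sub>R R"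
    by (auto simp: vec2_eq_iff tri_def algebra_simps)
  then have "(1 / tri P Q R) *\<^sub>R (tri P Q R *\<^sub>R V) =
    (1 / tri P Q R) *\<^sub>R (tri V Q R *\<^sub>R P + tri V R P *\<^sub>R Q + tri V P Q *\<^sub>R R)" by simp
  then show ?thesis using assms
    by (simp add: bary_def tri_perm(3)[of Q R P] tri_perm(3)[of P Q R] scaleR_add_right)
qed

lemma bary_nonneg:
  assumes "tri P Q R \<noteq> 0" "V \<in> convex hull {P, Q, R}"
  shows "0 \<le> bary P Q R V"
proof -
  obtain u v w where uvw: "0 \<le> u" "0 \<le> v" "0 \<le> w" "u + v + w = 1"
    and V: "V = u *\<^sub>R P + v *\<^sub>R Q + w *\<^sub>R R"
    using assms(2) by (auto simp: convex_hull_3)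
  have u: "u = 1 - v - w" using uvw by simp
  have "tri V Q R = u * tri P Q R" unfolding V u
    by (simp add: tri_def algebra_simps)
  then show ?thesis using assms uvw by (simp add: bary_def)
qed

lemma in_hull_3I:
  assumes "0 \<le> u" "0 \<le> v" "0 \<le> w" "u + v + w = 1" "V = u *\<^sub>R P + v *\<^sub>R Q + w *\<^sub>R R"
  shows "V \<in> convex hull {P, Q, R}"
  using assms by (auto simp: convex_hull_3)

lemma isosceles_container_iff:
  "isosceles_container T T' \<longleftrightarrow>
    (\<exists>P Q R. tri P Q R \<noteq> 0 \<and> dist P Q = dist P R \<and> T' = convex hull {P, Q, R} \<and> T \<subseteq> T')"
  by (auto simp: isosceles_container_def isosceles_triangle_def collinear_iff_tri)

lemma area_mono:
  assumes "convex hull {A, B, C} \<subseteq> convex hull {P, Q, R}"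
  shows "\<bar>tri A B C\<bar> \<le> \<bar>tri P Q R\<bar>"
proof -
  have "measure lebesgue (convex hull {A, B, C}) \<le> measure lebesgue (convex hull {P, Q, R})"
    using assms finite_imp_compact_convex_hull[of "{A, B, C}"]
      finite_imp_compact_convex_hull[of "{P, Q, R}"]
    by (intro measure_mono_fmeasurable) (auto simp: lmeasurable_compact fmeasurableD)
  then show ?thesis using area_triangle[of A B C] area_triangle[of P Q R]
    by (simp add: area_def)
qed

section \<open>The inequalities behind the flush case\<close>

text \<open>
  Here \<open>a\<close>, \<open>b\<close> are the squared lengths of the sides of \<open>T\<close> at some vertex and \<open>d\<close> that of the opposite
  side: the special containers of both kinds with apex at this vertex have at least \<open>\<tau>\<close> times the
  area of \<open>T\<close>.
\<close>

definition corner :: "real \<Rightarrow> real \<Rightarrow> real \<Rightarrow> real \<Rightarrow> bool" where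
  "corner \<tau> a b d \<longleftrightarrow>
     (b \<le> a \<longrightarrow> \<tau>\<^sup>2 * b \<le> a \<and> \<tau> * d \<le> d + a - b) \<and>
     (a \<le> b \<longrightarrow> \<tau>\<^sup>2 * a \<le> b \<and> \<tau> * d \<le> d + b - a)"

lemma corner_sym: "corner \<tau> a b d \<longleftrightarrow> corner \<tau> b a d"
  by (auto simp: corner_def)

text \<open>\<open>k\<close> is the share of \<open>T\<close> in the area of its container. In the
  flush configurations it is a polynomial in the coordinates, so multiplying by it clears \<tau>
  from the bounds.\<close>

lemma cornerD:
  assumes "corner \<tau> a b d" "k * \<tau> = 1" "0 < k" "b \<le> a"
  shows "b \<le> k\<^sup>2 * a" "d \<le> k * (d + a - b)"
proof -
  have "k\<^sup>2 * (\<tau>\<^sup>2 * b) \<le> k\<^sup>2 * a" "k * (\<tau> * d) \<le> k * (d + a - b)"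
    using assms by (auto simp: corner_def intro!: mult_left_mono)
  moreover have "k\<^sup>2 * (\<tau>\<^sup>2 * b) = (k * \<tau>)\<^sup>2 * b" "k * (\<tau> * d) = (k * \<tau>) * d"
    by (simp_all add: power_mult_distrib)
  ultimately show "b \<le> k\<^sup>2 * a" "d \<le> k * (d + a - b)" using assms(2) by simp_all
qed

text \<open>\<open>T\<close> occupies a whole leg. If its third vertex lay on neither of the other
  sides, the first-kind rival at the apex would force p + 2 r c \<le> 0, hence an obtuse apex angle.
  The second-kind rival at the same vertex would require (1 - p - r) ((1 - p - r) - 2 r c) \<le> 0,
  which is impossible for c < 0.\<close>

lemma leg_shared_leg:
  fixes p r c \<tau> :: real
  assumes "0 \<le> p" "0 < r" "p + r \<le> 1" "c < 1" and \<tau>: "r * \<tau> = 1"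
    and X: "corner \<tau> 1 (p\<^sup>2 + 2*p*r*c + r\<^sup>2) ((1-p)\<^sup>2 - 2*(1-p)*r*c + r\<^sup>2)"
  shows "p = 0 \<or> p + r = 1"
proof (rule ccontr)
  assume "\<not> ?thesis"
  then have p: "0 < p" "p + r < 1" using assms by auto
  define E where "E = p\<^sup>2 + 2*p*r*c + r\<^sup>2"
  have "p * r * c \<le> p * r" using assms p by (simp add: mult_left_le)
  then have "E \<le> (p + r)\<^sup>2" by (simp add: E_def power2_eq_square algebra_simps)
  also have "\<dots> < 1" using p assms by (simp add: power_less_one_iff)
  finally have E1: "E \<le> 1" by simp
  note * = cornerD[OF X[folded E_def] \<tau> \<open>0 < r\<close> E1]
  have "p * (p + 2*r*c) \<le> 0" using *(1) by (simp add: E_def power2_eq_square algebra_simps)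
  then have "p + 2*r*c \<le> 0" using p by (simp add: mult_le_0_iff)
  then have rc: "r * c < 0" using p by linarith
  have "(1 - p - r) * ((1 - p - r) - 2*r*c) \<le> 0"
    using *(2) unfolding E_def by (simp add: power2_eq_square algebra_simps)
  moreover have "0 < (1 - p - r) * ((1 - p - r) - 2*r*c)"
    using p rc by (intro mult_pos_pos; linarith)
  ultimately show False by linarith
qed

text \<open>\<open>T\<close> has a vertex at the apex, one inside a leg and one on the base. The
  first-kind rival at the apex gives E \<le> D, the second-kind rival at \<open>Z\<close> gives 1 <
  2 r, and the second-kind rival at the apex then gives K \<le> 0 for an expression K that is affine
  in q and positive on the range of q.\<close>

lemma leg_shared_apex:
  fixes y r c \<tau> :: real
  assumes "0 < y" "y < 1" "0 < r" "r \<le> 1" "-1 < c" "c < 1" and \<tau>: "y * r * \<tau> = 1"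
    and DEF: "D = y\<^sup>2" "E = (1-r)\<^sup>2 + 2*(1-r)*r*c + r\<^sup>2" "F = (y-(1-r))\<^sup>2 - 2*(y-(1-r))*r*c + r\<^sup>2"
    and X: "corner \<tau> D E F" and Z: "corner \<tau> E F D"
  shows "r = 1"
proof (rule ccontr)
  assume "r \<noteq> 1"
  then have r1: "r < 1" using assms by simp
  \<comment> \<open>\<open>1 - q\<close> is the coordinate of the foot of \<open>Z\<close> on the
    leg, measured from the apex; in terms of \<open>q\<close>, both \<open>E\<close> and
    \<open>F\<close> are affine.\<close>
  define q where "q = r * (1 - c)"
  have "r * (1 - c) < r * 2" using assms(3,5) by simp
  then have q: "0 < q" "q < 2 * r" using assms(3,6) by (simp_all add: q_def)
  have E: "E = 1 - 2 * (1 - r) * q" by (simp add: DEF q_def power2_eq_square algebra_simps)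
  have F: "F = y\<^sup>2 - 2 * y * (1 - q) + E" by (simp add: DEF q_def power2_eq_square algebra_simps)
  have E1: "E < 1" using r1 q unfolding E by simp
  have yr: "0 < y * r" using assms by simp
  have Epos: "0 < E"
  proof -
    have "(1 - r) * q < (1 - r) * (2 * r)" using r1 q by (intro mult_strict_left_mono) auto
    then have "(1 - 2 * r)\<^sup>2 < E" unfolding E by (simp add: power2_eq_square algebra_simps)
    then show ?thesis using zero_le_power2[of "1 - 2 * r"] by linarith
  qed
  have ED: "E \<le> D"
  proof (rule ccontr)
    assume "\<not> E \<le> D"
    then have "D \<le> (y * r)\<^sup>2 * E" using cornerD(1)[of \<tau> E D F "y * r"] X \<tau> yr by (simp add: corner_sym)
    then have "y\<^sup>2 * 1 \<le> y\<^sup>2 * (r\<^sup>2 * E)" by (simp add: DEF(1) power_mult_distrib mult.assoc)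
    then have "1 \<le> r\<^sup>2 * E" using assms by (subst (asm) mult_le_cancel_left_pos) auto
    also have "\<dots> \<le> 1 * E" using r1 assms Epos by (intro mult_right_mono) (auto simp: power_le_one)
    finally show False using E1 by simp
  qed
  have r2: "1 < 2 * r"
  proof (cases "F \<le> E")
    case True
    then have "D \<le> (y * r) * (D + E - F)" using cornerD(2)[OF Z \<tau> yr] by simp
    also have "D + E - F = 2 * y * (1 - q)" by (simp add: F DEF(1))
    also have "y * r * (2 * y * (1 - q)) = y\<^sup>2 * (2 * r * (1 - q))" by (simp add: power2_eq_square)
    finally have "1 \<le> 2 * r * (1 - q)" unfolding DEF(1) using assms by simp
    also have "\<dots> < 2 * r * 1" using q assms by (intro mult_strict_left_mono) auto
    finally show ?thesis by simp
  next
    case False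
    then have "D \<le> (y * r) * (D + F - E)" using cornerD(2)[of \<tau> F E D "y * r"] Z \<tau> yr by (simp add: corner_sym)
    also have "D + F - E = 2 * y * (y - 1 + q)" by (simp add: F DEF(1) power2_eq_square algebra_simps)
    also have "y * r * (2 * y * (y - 1 + q)) = y\<^sup>2 * (2 * r * (y - 1 + q))" by (simp add: power2_eq_square)
    finally have "1 \<le> 2 * r * (y - 1 + q)" unfolding DEF(1) using assms by simp
    also have "\<dots> < 2 * r * (2 * r)" using q assms by (intro mult_strict_left_mono) auto
    finally have "1\<^sup>2 < (2 * r)\<^sup>2" by (simp add: power2_eq_square)
    then show ?thesis using assms(3) by (metis power_less_imp_less_base less_eq_real_def mult_pos_pos zero_less_numeral)
  qed
  define K where "K = 2*r*y\<^sup>2 + 1 - y + 2*q*(r*y + r - 1)"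
  have "F \<le> (y * r) * (F + D - E)" using cornerD(2)[OF X \<tau> yr ED] by simp
  then have "0 \<le> (y - 1) * K" unfolding F E DEF(1) K_def by (simp add: power2_eq_square algebra_simps)
  then have "K \<le> 0" using assms by (simp add: zero_le_mult_iff)
  moreover have "0 < K"
  proof (cases "0 \<le> r*y + r - 1")
    case True
    have "0 < 1 - y" using assms by simp
    moreover have "0 \<le> 2*r*y\<^sup>2" "0 \<le> 2*q*(r*y + r - 1)" using True q assms by simp_all
    ultimately show ?thesis unfolding K_def by linarith
  next
    case False
    \<comment> \<open>The slope of \<open>K\<close> in \<open>q\<close> is negative here, so the
      value at q = 2 r is a lower bound. It factors, and 1 < 2 r makes both factors
      positive.\<close>
    have "1 * 1 < (1 + y) * (2 * r)" using r2 assms(1) by (intro mult_strict_mono) auto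
    moreover have "0 < 2 * r - (1 - y)" using r2 assms(1) by linarith
    ultimately have "0 < ((1 + y) * (2 * r) - 1) * (2 * r - (1 - y))" by simp
    moreover have "((1 + y) * (2 * r) - 1) * (2 * r - (1 - y)) = 2*r*y\<^sup>2 + 1 - y + 2*(2*r)*(r*y + r - 1)"
      by (simp add: power2_eq_square algebra_simps)
    moreover have "2*(2*r)*(r*y + r - 1) \<le> 2*q*(r*y + r - 1)"
      using False q by (intro mult_right_mono_neg) auto
    ultimately show ?thesis by (simp add: K_def)
  qed
  ultimately show False by simp
qed

text \<open>\<open>T\<close> has a vertex at an end of the base, one inside the leg issuing from
  there and one on the other leg. If D \<le> E, the second-kind rival at \<open>X\<close> is smaller
  than the container. Otherwise the two rivals at \<open>X\<close> and the second-kind rival at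
  \<open>Z\<close> leave no room for \<open>r\<close> and \<open>x\<close>.\<close>

lemma leg_shared_base_vertex:
  fixes x r c \<tau> :: real
  assumes "0 < x" "x < 1" "0 < r" "r \<le> 1" "c < 1" and \<tau>: "(1 - x) * r * \<tau> = 1"
    and DEF: "D = (1-x)\<^sup>2" "E = x\<^sup>2 - 2*x*r*c + r\<^sup>2" "F = 1 - 2*r*c + r\<^sup>2"
    and X: "corner \<tau> D E F" and Z: "corner \<tau> E F D"
  shows False
proof -
  define g where "g = 2 * r * c"
  have g: "g < 2 * r" using assms(3,5) by (simp add: g_def)
  have E: "E = x\<^sup>2 - x * g + r\<^sup>2" and F: "F = 1 - g + r\<^sup>2" by (simp_all add: DEF g_def)
  have k: "0 < (1 - x) * r" using assms by simp
  have Fpos: "0 < F"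
  proof -
    have "0 \<le> (1 - r)\<^sup>2" by simp
    then show ?thesis using g unfolding F by (simp add: power2_eq_square algebra_simps)
  qed
  have g2: "g < 2" using g assms by simp
  show False
  proof (cases "D \<le> E")
    case True
    have "F \<le> ((1 - x) * r) * (F + E - D)"
      using cornerD(2)[of \<tau> E D F] X \<tau> k True by (simp add: corner_sym)
    moreover have "((1 - x) * r) * (F + E - D) < F"
    proof -
      define m where "m = E - D"
      have m: "0 \<le> m" using True by (simp add: m_def)
      have mx: "x * (2 - g) = 1 - r\<^sup>2 + m" by (simp add: m_def E DEF(1) power2_eq_square algebra_simps)
      \<comment> \<open>The factor \<open>2 - g\<close> is positive and lets \<open>mx\<close>
        eliminate \<open>x\<close>. The result is a sum of nonnegative terms: the first is positive
        for r < 1, the last for r = 1.\<close>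
      have "(2 - g) * (F - ((1 - x) * r) * (F + m)) = (2 - g) * F - r * ((2 - g) - x * (2 - g)) * (F + m)"
        by (simp add: algebra_simps)
      also have "\<dots> = (2 - g) * F - r * (F - m) * (F + m)"
        unfolding mx by (simp add: F)
      also have "\<dots> = (1 - r) * F\<^sup>2 + (1 - r\<^sup>2) * F + r * m\<^sup>2"
        by (simp add: F power2_eq_square algebra_simps)
      also have "\<dots> > 0"
      proof (cases "r = 1")
        case True
        then have "0 < m" using mx assms g2 by (metis add.commute add_0 diff_self mult_pos_pos one_power2 diff_gt_0_iff_gt)
        then show ?thesis using True by simp
      next
        case False
        then have "0 < 1 - r" "0 \<le> 1 - r\<^sup>2" using assms by (auto simp: power_le_one)
        then show ?thesis using Fpos assms by (intro add_pos_nonneg) auto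
      qed
      finally have "0 < F - ((1 - x) * r) * (F + m)" using g2 by (simp add: zero_less_mult_iff)
      then show ?thesis by (simp add: m_def algebra_simps)
    qed
    ultimately show False by simp
  next
    case False
    then have ED: "E \<le> D" by simp
    have F1: "E \<le> ((1 - x) * r)\<^sup>2 * D" and G1: "F \<le> ((1 - x) * r) * (F + D - E)"
      using cornerD[OF X \<tau> k ED] by simp_all
    \<comment> \<open>The distance of \<open>X\<close> and \<open>Z\<close> is at least the
      difference of their distances from the apex. Together with the first-kind bound this yields r
      (2 - x) \<le> 1.\<close>
    have "(r - x)\<^sup>2 \<le> E"
    proof -
      have "x * g \<le> x * (2 * r)" using g assms by (intro mult_left_mono) auto
      then show ?thesis unfolding E by (simp add: power2_eq_square algebra_simps)
    qed
    also have "E \<le> ((1 - x)\<^sup>2 * r)\<^sup>2" using F1 by (simp add: DEF(1) power2_eq_square algebra_simps)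
    finally have "r - x \<le> (1 - x)\<^sup>2 * r" using assms by (simp add: power2_le_iff_abs_le)
    then have "x * (r * (2 - x)) \<le> x * 1" by (simp add: power2_eq_square algebra_simps)
    then have rx: "r * (2 - x) \<le> 1" using assms by (simp add: mult_le_cancel_left_pos)
    have D1: "D < 1" using assms by (simp add: DEF(1) power_less_one_iff)
    have Dn: "F \<le> D * r * (2 - g)" 
    proof -
      have "F + D - E = (1 - x) * (2 - g)" by (simp add: F E DEF(1) power2_eq_square algebra_simps)
      then have "F \<le> (1 - x) * r * ((1 - x) * (2 - g))" using G1 by simp
      then show ?thesis by (simp add: DEF(1) power2_eq_square mult_ac)
    qed
    consider "1 \<le> r * (2 - g)" | "1 \<le> r * (g - 2 * x)"
    proof (cases "E \<le> F")
      case True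
      have "D \<le> ((1 - x) * r) * (D + F - E)" 
        using cornerD(2)[of \<tau> F E D] Z \<tau> k True by (simp add: corner_sym)
      also have "D + F - E = (1 - x) * (2 - g)" by (simp add: F E DEF(1) power2_eq_square algebra_simps)
      also have "(1 - x) * r * ((1 - x) * (2 - g)) = (1 - x)\<^sup>2 * (r * (2 - g))" by (simp add: power2_eq_square)
      finally show ?thesis using that assms unfolding DEF(1) by simp
    next
      case False
      have "D \<le> ((1 - x) * r) * (D + E - F)" 
        using cornerD(2)[OF Z \<tau> k] False by simp
      also have "D + E - F = (1 - x) * (g - 2 * x)" by (simp add: F E DEF(1) power2_eq_square algebra_simps)
      also have "(1 - x) * r * ((1 - x) * (g - 2 * x)) = (1 - x)\<^sup>2 * (r * (g - 2 * x))" by (simp add: power2_eq_square)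
      finally show ?thesis using that assms unfolding DEF(1) by simp
    qed
    then show False
    proof cases
      case 2
      have "r * (g - 2 * x) < r * (2 * r - 2 * x)" using g assms by (intro mult_strict_left_mono) auto
      then have *: "1 < 2 * (r * (r - x))" using 2 by (simp add: algebra_simps)
      have "0 < r * (r - x)" using * by simp
      then have "x < r" using assms by (simp add: zero_less_mult_iff)
      have "r * (r - x) \<le> 1 * (r - x)" using \<open>x < r\<close> assms by (intro mult_right_mono) auto
      then have "x < 1 / 2" using * assms by simp
      have "r * (3 / 2) \<le> r * (2 - x)" using \<open>x < 1 / 2\<close> assms by (intro mult_left_mono) auto
      then have "r \<le> 2 / 3" using rx by simp
      then have "r * (r - x) \<le> 2/3 * (2/3)" using assms \<open>x < r\<close> by (intro mult_mono) auto
      then show False using * by simp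
    next
      case 1
      \<comment> \<open>The rival at \<open>Z\<close> bounds \<open>g\<close> from above, the
        second-kind rival at \<open>X\<close> bounds it from below. Both bounds are multiplied by r
        (1 - D r), or a factor of it, so that \<open>g\<close> cancels.\<close>
      have gg: "r * (1 - D * r) * g \<le> (2 * r - 1) * (1 - D * r)"
      proof -
        have "0 \<le> 1 - D * r" using D1 assms DEF(1) by (simp add: mult_le_one)
        then have "(r * g) * (1 - D * r) \<le> (2 * r - 1) * (1 - D * r)" using 1 by (intro mult_right_mono) (auto simp: algebra_simps)
        then show ?thesis by (simp add: algebra_simps)
      qed
      have "1 + r\<^sup>2 - 2 * D * r \<le> g * (1 - D * r)" using Dn by (simp add: F algebra_simps)
      then have "r * (1 + r\<^sup>2 - 2 * D * r) \<le> r * (g * (1 - D * r))" using assms by (intro mult_left_mono) auto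
      then have "r * (1 + r\<^sup>2 - 2 * D * r) \<le> (2 * r - 1) * (1 - D * r)" using gg by (simp add: algebra_simps)
      then have a: "r + r^3 + 1 \<le> 2 * r + D * r" by (simp add: power2_eq_square power3_eq_cube algebra_simps)
      have "r * (1 - x) \<le> 1 - r" using rx by (simp add: algebra_simps)
      then have "(r * (1 - x))\<^sup>2 \<le> (1 - r)\<^sup>2" using assms by (intro power_mono) auto
      then have b: "r\<^sup>2 * D \<le> (1 - r)\<^sup>2" by (simp add: DEF(1) power_mult_distrib)
      have "r * (r + r^3 + 1) \<le> r * (2 * r + D * r)" using a assms by (intro mult_left_mono) auto
      then have "r * (r + r^3 + 1) \<le> 2 * r\<^sup>2 + (1 - r)\<^sup>2" using b by (simp add: power2_eq_square algebra_simps)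
      then have c: "r^4 + 3 * r \<le> 2 * r\<^sup>2 + 1" by (simp add: power2_eq_square power4_eq_xxxx power3_eq_cube algebra_simps)
      have "r < 1" 
      proof -
        have "r * 1 < r * (2 - x)" using assms by (intro mult_strict_left_mono) auto
        then show ?thesis using rx by simp
      qed
      moreover have "1 / 2 < r"
      proof -
        have "((1 - x)\<^sup>2 * r)\<^sup>2 \<le> r\<^sup>2" using D1 assms unfolding DEF(1)
          by (intro power_mono) (auto simp: mult_le_cancel_right1)
        then have "x\<^sup>2 \<le> x * g" using \<open>E \<le> ((1 - x)\<^sup>2 * r)\<^sup>2\<close> E by linarith
        then have "x * x \<le> x * g" by (simp add: power2_eq_square)
        then have "x \<le> g" using assms(1) by (simp add: mult_le_cancel_left_pos)
        then have "0 < r * g" using assms(1,3) by simp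
        then show ?thesis using 1 by (simp add: algebra_simps)
      qed
      ultimately have "0 < (1 - r) * (2 * r - 1)" by simp
      then have "0 < 3 * r - 2 * r\<^sup>2 - 1" by (simp add: power2_eq_square algebra_simps)
      moreover have "0 \<le> r^4" by simp
      ultimately show False using c by linarith
    qed
  qed
qed

text \<open>Two vertices lie inside a leg and the third is the end of the other leg. The first-kind
  rival at \<open>X\<close> forces the side from \<open>X\<close> to \<open>Z\<close> to be at least
  as long as the leg, so x \<ge> 2 c; then the second-kind rival at \<open>X\<close> is strictly
  smaller than the container.\<close>

lemma leg_shared_opposite_vertex:
  fixes x y c \<tau> :: real
  assumes "0 < x" "x < y" "y < 1" "c < 1" and \<tau>: "(y - x) * \<tau> = 1"
    and DEF: "D = (y-x)\<^sup>2" "E = x\<^sup>2 - 2*x*c + 1" "F = y\<^sup>2 - 2*y*c + 1"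
    and X: "corner \<tau> D E F"
  shows False
proof -
  have k: "0 < y - x" using assms by simp
  have DE: "D \<le> E"
  proof -
    have "x * c \<le> x * 1" using assms by (intro mult_left_mono) auto
    moreover have "(y - x)\<^sup>2 \<le> (1 - x)\<^sup>2" using assms by (intro power_mono) auto
    ultimately show ?thesis by (simp add: DEF power2_eq_square algebra_simps)
  qed
  have "D \<le> (y - x)\<^sup>2 * E" and G: "F \<le> (y - x) * (F + E - D)"
    using cornerD[of \<tau> E D F] X \<tau> k DE by (simp_all add: corner_sym)
  then have "1 \<le> E" using k by (simp add: DEF(1))
  then have "0 \<le> x * (x - 2 * c)" by (simp add: DEF power2_eq_square algebra_simps)
  then have xc: "0 \<le> x - 2 * c" using assms by (simp add: zero_le_mult_iff)
  define d where "d = y - x"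
  have y: "y = x + d" by (simp add: d_def)
  have d: "0 < d" "d < 1" using assms by (auto simp: d_def)
  have "F - d * (F + E - D) = (1 - d)\<^sup>2 + x * d * (1 - d) + (y - y * y + x * x) * (x - 2 * c)"
    unfolding DEF y by (simp add: power2_eq_square algebra_simps)
  also have "\<dots> > 0"
  proof -
    have "y * y \<le> y" using assms by (simp add: mult_left_le)
    then have "0 \<le> (y - y * y + x * x) * (x - 2 * c)" using xc by (intro mult_nonneg_nonneg) auto
    moreover have "0 \<le> x * d * (1 - d)" "0 < (1 - d)\<^sup>2" using d assms by auto
    ultimately show ?thesis by linarith
  qed
  finally show False using G by (simp add: d_def)
qed

text \<open>
  The frame has its apex \<open>P\<close> at the origin and legs \<open>P Q\<close>, \<open>P R\<close> of length \<open>1\<close> at an angle with cosine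
  \<open>c\<close>; \<open>X\<close>, \<open>Y\<close> lie on \<open>P Q\<close> at distance \<open>x\<close>, \<open>y\<close> from \<open>P\<close>, and \<open>Z\<close> has affine coordinates \<open>p\<close>, \<open>r\<close>.
  The two disjunctions say that \<open>P R\<close> and \<open>Q R\<close> meet \<open>T\<close>, and \<open>\<tau>\<close> is the ratio of the areas. The three
  conclusions are the special containers.
\<close>

lemma leg_algebra:
  fixes x y p r c \<tau> :: real
  assumes xy: "0 \<le> x" "x < y" "y \<le> 1" and pr: "0 \<le> p" "0 < r" "p + r \<le> 1"
    and c: "-1 < c" "c < 1" and t: "x = 0 \<or> p = 0" "y = 1 \<or> p + r = 1"
    and \<tau>: "(y - x) * r * \<tau> = 1"
    and DEF: "D = (y-x)\<^sup>2" "E = (p-x)\<^sup>2 + 2*(p-x)*r*c + r\<^sup>2" "F = (y-p)\<^sup>2 - 2*(y-p)*r*c + r\<^sup>2"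
    and X: "corner \<tau> D E F" and Z: "corner \<tau> E F D"
  shows "x = 0 \<and> y = 1 \<and> (p = 0 \<or> p + r = 1) \<or> x = 0 \<and> p = 0 \<and> r = 1"
proof (cases "x = 0")
  case x: True
  have E: "E = p\<^sup>2 + 2*p*r*c + r\<^sup>2" and D: "D = y\<^sup>2" unfolding DEF x by simp_all
  show ?thesis
  proof (cases "y = 1")
    case True
    have "D = 1" "F = (1-p)\<^sup>2 - 2*(1-p)*r*c + r\<^sup>2" "r * \<tau> = 1" using D DEF(3) \<tau> x True by simp_all
    then show ?thesis using leg_shared_leg[OF pr c(2)] X True x unfolding E by blast
  next
    case False
    have p: "p = 1 - r" using False t(2) by simp
    have y: "0 < y" "y < 1" "y * r * \<tau> = 1" using xy \<tau> x False by simp_all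
    have "r \<le> 1" using p pr(1) by simp
    then have "r = 1" by (rule leg_shared_apex[OF y(1,2) pr(2) _ c y(3) D E[unfolded p] DEF(3)[unfolded p] X Z])
    then show ?thesis using x p by simp
  qed
next
  case False
  then have x: "0 < x" "p = 0" using t xy by auto
  have r: "r \<le> 1" using pr by simp
  have E: "E = x\<^sup>2 - 2*x*r*c + r\<^sup>2" and F: "F = y\<^sup>2 - 2*y*r*c + r\<^sup>2" unfolding DEF x(2) by simp_all
  show ?thesis
  proof (cases "y = 1")
    case True
    have "F = 1 - 2*r*c + r\<^sup>2" "D = (1-x)\<^sup>2" "x < 1" "(1 - x) * r * \<tau> = 1" using F DEF(1) xy \<tau> True by simp_all
    then show ?thesis using leg_shared_base_vertex[OF x(1) _ pr(2) r c(2) _ _ E _ X Z] by blast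
  next
    case False
    then have r: "r = 1" and y: "y < 1" using t(2) x xy by auto
    have "(y - x) * \<tau> = 1" "E = x\<^sup>2 - 2*x*c + 1" "F = y\<^sup>2 - 2*y*c + 1" using \<tau> E F r by simp_all
    then show ?thesis using leg_shared_opposite_vertex[OF x(1) xy(2) y c(2) _ DEF(1) _ _ X] by blast
  qed
qed

text \<open>With the base as unit of length, \<open>p + r / 2\<close> is the foot of
  \<open>Z\<close> on the base and \<open>h\<close> its squared height. In the second-kind rival
  with apex \<open>Z\<close> the height cancels from E - F, and what remains implies 1 \<le> r (2 -
  r), that is r = 1.\<close>

lemma base_algebra:
  fixes x y p r h \<tau> :: real
  assumes xy: "0 \<le> x" "x < y" "y \<le> 1" and pr: "0 \<le> p" "0 < r" "p + r \<le> 1"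
    and t: "x = 0 \<or> p = 0" "y = 1 \<or> p + r = 1"
    and \<tau>: "(y - x) * r * \<tau> = 1"
    and DEF: "D = (y-x)\<^sup>2" "E = (p+r/2-x)\<^sup>2 + h" "F = (p+r/2-y)\<^sup>2 + h"
    and Z: "corner \<tau> E F D"
  shows "p = 0 \<and> r = 1 \<and> (x = 0 \<or> y = 1)"
proof -
  have k: "0 < (y - x) * r" using xy pr by simp
  have r: "r = 1" if "1 \<le> r * (2 - r)"
  proof -
    have "(1 - r)\<^sup>2 \<le> 0" using that by (simp add: power2_eq_square algebra_simps)
    then show ?thesis by simp
  qed
  have r': "r * a \<le> r * (2 - r)" if "a \<le> 2 - r" for a using that pr by (intro mult_left_mono) auto
  consider "1 \<le> r * (2 * p + r - 2 * x)" | "1 \<le> r * (2 * y - 2 * p - r)"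
  proof (cases "F \<le> E")
    case True
    have "D \<le> (y - x) * r * (D + E - F)" using cornerD(2)[OF Z \<tau> k True] by simp
    also have "D + E - F = (y - x) * (2 * p + r - 2 * x)" by (simp add: DEF power2_eq_square algebra_simps)
    also have "(y - x) * r * ((y - x) * (2 * p + r - 2 * x)) = (y - x)\<^sup>2 * (r * (2 * p + r - 2 * x))" by (simp add: power2_eq_square)
    finally show ?thesis using that xy unfolding DEF(1) by simp
  next
    case False
    have "D \<le> (y - x) * r * (D + F - E)" 
      using cornerD(2)[of \<tau> F E D] Z \<tau> k False by (simp add: corner_sym)
    also have "D + F - E = (y - x) * (2 * y - 2 * p - r)" by (simp add: DEF power2_eq_square algebra_simps)
    also have "(y - x) * r * ((y - x) * (2 * y - 2 * p - r)) = (y - x)\<^sup>2 * (r * (2 * y - 2 * p - r))" by (simp add: power2_eq_square)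
    finally show ?thesis using that xy unfolding DEF(1) by simp
  qed
  then show ?thesis
  proof cases
    case 1
    moreover have "r * (2 * p + r - 2 * x) \<le> r * (2 - r)" using xy pr by (intro r') auto
    ultimately have "r = 1" using r by linarith
    then show ?thesis using 1 pr xy by auto
  next
    case 2
    moreover have "r * (2 * y - 2 * p - r) \<le> r * (2 - r)" using xy pr by (intro r') auto
    ultimately have "r = 1" using r by linarith
    then show ?thesis using 2 pr xy by auto
  qed
qed

section \<open>Special containers and flush minimum containers\<close>

text \<open>
  For \<open>dist X Z \<le> dist X Y\<close>, the triangles \<open>leg_container X Y Z\<close> and \<open>base_container X Y Z\<close> below, both
  with apex \<open>X\<close> and leg \<open>X Y\<close>, are the special containers of the first and of the second kind.
\<close>

definition leg_ext :: "point \<Rightarrow> point \<Rightarrow> point \<Rightarrow> point" where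
  "leg_ext X Y Z = X + (dist X Y / dist X Z) *\<^sub>R (Z - X)"

text \<open>The second point where the line through \<open>Y\<close> and \<open>Z\<close> meets the
  circle around \<open>X\<close> through \<open>Y\<close>. For \<open>Z\<close> inside the circle
  the numerator is the power of \<open>Z\<close> up to sign, so the quotient is the distance from
  \<open>Z\<close> to that point in units of \<open>dist Y Z\<close>.\<close>

definition base_ext :: "point \<Rightarrow> point \<Rightarrow> point \<Rightarrow> point" where
  "base_ext X Y Z = Y + (1 + ((dist X Y)\<^sup>2 - (dist X Z)\<^sup>2) / (dist Y Z)\<^sup>2) *\<^sub>R (Z - Y)"

definition leg_container :: "point \<Rightarrow> point \<Rightarrow> point \<Rightarrow> point set" where
  "leg_container X Y Z = convex hull {X, Y, leg_ext X Y Z}"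

definition base_container :: "point \<Rightarrow> point \<Rightarrow> point \<Rightarrow> point set" where
  "base_container X Y Z = convex hull {X, Y, base_ext X Y Z}"

lemma tri_neqD: "tri X Y Z \<noteq> 0 \<Longrightarrow> X \<noteq> Y \<and> X \<noteq> Z \<and> Y \<noteq> Z"
  by (auto simp: tri_def)

lemma tri_leg: "tri X Y (X + s *\<^sub>R (Z - X)) = s * tri X Y Z"
  by (simp add: tri_def algebra_simps)

lemma tri_base: "tri X Y (Y + s *\<^sub>R (Z - Y)) = s * tri X Y Z"
  by (simp add: tri_def algebra_simps)

lemma hull_stretch:
  assumes "V \<in> {X, Y}" "1 \<le> s"
  shows "convex hull {X, Y, Z} \<subseteq> convex hull {X, Y, V + s *\<^sub>R (Z - V)}"
proof -
  define W where "W = V + s *\<^sub>R (Z - V)"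
  have "Z = (1 - 1/s) *\<^sub>R V + (1/s) *\<^sub>R W"
    using assms(2) by (simp add: W_def algebra_simps)
  moreover have "(1 - 1/s) *\<^sub>R V + (1/s) *\<^sub>R W \<in> convex hull {X, Y, W}"
    using assms by (intro convexD_alt[where a=V and b=W] convex_convex_hull) (auto intro: hull_inc) 
  ultimately have "Z \<in> convex hull {X, Y, W}" by simp
  then show ?thesis unfolding W_def[symmetric]
    by (intro hull_minimal convex_convex_hull) (auto intro: hull_inc)
qed

lemma leg_container:
  assumes t: "tri X Y Z \<noteq> 0" and le: "dist X Z \<le> dist X Y"
  shows "isosceles_container (convex hull {X, Y, Z}) (leg_container X Y Z)"
    and "area (leg_container X Y Z) = dist X Y / dist X Z * area (convex hull {X, Y, Z})"
proof -
  define s where "s = dist X Y / dist X Z"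
  have d: "0 < dist X Z" using tri_neqD[OF t] by simp
  then have s: "1 \<le> s" using le by (simp add: s_def)
  have e: "leg_container X Y Z = convex hull {X, Y, X + s *\<^sub>R (Z - X)}"
    by (simp add: leg_container_def leg_ext_def s_def)
  have "dist X (X + s *\<^sub>R (Z - X)) = s * dist X Z"
    using s by (simp add: dist_norm norm_minus_commute)
  then have "dist X Y = dist X (X + s *\<^sub>R (Z - X))" using d by (simp add: s_def)
  moreover have "tri X Y (X + s *\<^sub>R (Z - X)) \<noteq> 0" using s t by (simp add: tri_leg)
  ultimately show "isosceles_container (convex hull {X, Y, Z}) (leg_container X Y Z)"
    unfolding isosceles_container_iff e using hull_stretch[of X X Y s Z] s by blast
  show "area (leg_container X Y Z) = dist X Y / dist X Z * area (convex hull {X, Y, Z})"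
    using s unfolding e s_def[symmetric] by (simp add: area_triangle tri_leg abs_mult)
qed

lemma dist_base_ext:
  fixes X Y Z :: point
  assumes "Y \<noteq> Z"
  shows "dist X (base_ext X Y Z) = dist X Y"
proof -
  define s where "s = 1 + ((dist X Y)\<^sup>2 - (dist X Z)\<^sup>2) / (dist Y Z)\<^sup>2"
  have "s * (dist Y Z)\<^sup>2 = (dist Y Z)\<^sup>2 + ((dist X Y)\<^sup>2 - (dist X Z)\<^sup>2)"
    using assms by (simp add: s_def distrib_right)
  then have "(dist X (Y + s *\<^sub>R (Z - Y)))\<^sup>2 = (dist X Y)\<^sup>2"
    unfolding dist2_eq vector_add_component vector_scaleR_component vector_minus_component real_scaleR_def
    by algebra
  then show ?thesis by (simp add: base_ext_def s_def)
qed

lemma base_container: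
  assumes t: "tri X Y Z \<noteq> 0" and le: "dist X Z \<le> dist X Y"
  shows "isosceles_container (convex hull {X, Y, Z}) (base_container X Y Z)"
    and "area (base_container X Y Z) =
      (1 + ((dist X Y)\<^sup>2 - (dist X Z)\<^sup>2) / (dist Y Z)\<^sup>2) * area (convex hull {X, Y, Z})"
proof -
  define s where "s = 1 + ((dist X Y)\<^sup>2 - (dist X Z)\<^sup>2) / (dist Y Z)\<^sup>2"
  have s: "1 \<le> s" using le by (simp add: s_def power_mono)
  have e: "base_container X Y Z = convex hull {X, Y, Y + s *\<^sub>R (Z - Y)}"
    by (simp add: base_container_def base_ext_def s_def)
  have "dist X Y = dist X (Y + s *\<^sub>R (Z - Y))"
    using dist_base_ext[of Y Z X] tri_neqD[OF t] by (simp add: base_ext_def s_def)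
  moreover have "tri X Y (Y + s *\<^sub>R (Z - Y)) \<noteq> 0" using s t by (simp add: tri_base)
  ultimately show "isosceles_container (convex hull {X, Y, Z}) (base_container X Y Z)"
    unfolding isosceles_container_iff e using hull_stretch[of Y X Y s Z] s by blast
  show "area (base_container X Y Z) =
      (1 + ((dist X Y)\<^sup>2 - (dist X Z)\<^sup>2) / (dist Y Z)\<^sup>2) * area (convex hull {X, Y, Z})"
    using s unfolding e s_def[symmetric] by (simp add: area_triangle tri_base abs_mult)
qed

text \<open>A vertex set instead of a triple, so that any labelling of the triangle may serve as
  witness.\<close>

definition special :: "point set \<Rightarrow> point set \<Rightarrow> bool" where
  "special S T' \<longleftrightarrow> (\<exists>X Y Z. S = {X, Y, Z} \<and> dist X Z \<le> dist X Y \<and>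
      (T' = leg_container X Y Z \<or> T' = base_container X Y Z))"

lemma special_legI:
  assumes "leg_ext X Y Z = W" "dist X Z \<le> dist X Y" "S = {X, Y, Z}" "U = {X, Y, W}"
  shows "special S (convex hull U)"
  using assms unfolding special_def leg_container_def by blast

lemma special_baseI:
  assumes "base_ext X Y Z = W" "dist X Z \<le> dist X Y" "S = {X, Y, Z}" "U = {X, Y, W}"
  shows "special S (convex hull U)"
  using assms unfolding special_def base_container_def by blast

lemma min_containerD:
  "min_isosceles_container T T' \<Longrightarrow> isosceles_container T T'' \<Longrightarrow> area T' \<le> area T''"
  by (auto simp: min_isosceles_container_def)

text \<open>The bridge from minimality to polynomials. Squared lengths are given up to a common
  factor \<open>k\<close>, which cancels. The first-kind bound is squared because its area ratio is
  a quotient of lengths; the second-kind ratio is already a quotient of squared lengths.\<close>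

lemma min_corner:
  assumes t: "tri X Y Z \<noteq> 0" and m: "min_isosceles_container (convex hull {X, Y, Z}) T'"
    and k: "0 < k" and \<tau>: "area T' = \<tau> * area (convex hull {X, Y, Z})"
    and abd: "(dist X Y)\<^sup>2 = k * a" "(dist X Z)\<^sup>2 = k * b" "(dist Y Z)\<^sup>2 = k * d"
  shows "corner \<tau> a b d"
proof -
  have half: "\<tau>\<^sup>2 * b \<le> a \<and> \<tau> * d \<le> d + a - b"
    if t: "tri X Y Z \<noteq> 0" and m: "min_isosceles_container (convex hull {X, Y, Z}) T'"
    and \<tau>: "area T' = \<tau> * area (convex hull {X, Y, Z})" and ab: "b \<le> a"
    and abd: "(dist X Y)\<^sup>2 = k * a" "(dist X Z)\<^sup>2 = k * b" "(dist Y Z)\<^sup>2 = k * d"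
    for X Y Z a b
  proof
    have A: "0 < area (convex hull {X, Y, Z})" using t by (simp add: area_triangle)
    have "(dist X Z)\<^sup>2 \<le> (dist X Y)\<^sup>2" using ab k by (simp add: abd)
    then have le: "dist X Z \<le> dist X Y" by (rule power2_le_imp_le) simp
    have d: "0 < dist X Z" "0 < dist Y Z" using tri_neqD[OF t] by simp_all
    have "0 \<le> \<tau> * area (convex hull {X, Y, Z})" unfolding \<tau>[symmetric] by (simp add: area_def)
    then have t0: "0 \<le> \<tau>" using A by (simp only: zero_le_mult_iff) linarith
    have "\<tau> * area (convex hull {X, Y, Z}) \<le> dist X Y / dist X Z * area (convex hull {X, Y, Z})"
      using min_containerD[OF m leg_container(1)[OF t le]] unfolding leg_container(2)[OF t le] \<tau> .
    then have "\<tau> \<le> dist X Y / dist X Z" using A by (simp only: mult_le_cancel_right_pos)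
    then have "\<tau> * dist X Z \<le> dist X Y" using d(1) by (simp only: pos_le_divide_eq)
    then have "(\<tau> * dist X Z)\<^sup>2 \<le> (dist X Y)\<^sup>2" using t0 by (intro power_mono) auto
    then have "k * (\<tau>\<^sup>2 * b) \<le> k * a" by (simp add: power_mult_distrib abd(1,2) mult.left_commute)
    then show "\<tau>\<^sup>2 * b \<le> a" using k by simp
    have "\<tau> * area (convex hull {X, Y, Z}) \<le>
        (1 + ((dist X Y)\<^sup>2 - (dist X Z)\<^sup>2) / (dist Y Z)\<^sup>2) * area (convex hull {X, Y, Z})"
      using min_containerD[OF m base_container(1)[OF t le]] unfolding base_container(2)[OF t le] \<tau> .
    then have "\<tau> \<le> 1 + ((dist X Y)\<^sup>2 - (dist X Z)\<^sup>2) / (dist Y Z)\<^sup>2"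
      using A by (simp only: mult_le_cancel_right_pos)
    then have "\<tau> * (dist Y Z)\<^sup>2 \<le> (1 + ((dist X Y)\<^sup>2 - (dist X Z)\<^sup>2) / (dist Y Z)\<^sup>2) * (dist Y Z)\<^sup>2"
      by (intro mult_right_mono) auto
    also have "\<dots> = (dist Y Z)\<^sup>2 + (dist X Y)\<^sup>2 - (dist X Z)\<^sup>2"
      using d(2) by (simp add: distrib_right)
    finally have "k * (\<tau> * d) \<le> k * (d + a - b)" unfolding abd by (simp add: algebra_simps)
    then show "\<tau> * d \<le> d + a - b" using k by simp
  qed
  have "\<tau>\<^sup>2 * b \<le> a \<and> \<tau> * d \<le> d + a - b" if "b \<le> a"
    using half[OF t m \<tau> that abd] .
  moreover have "\<tau>\<^sup>2 * a \<le> b \<and> \<tau> * d \<le> d + b - a" if "a \<le> b"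
  proof -
    have e: "{X, Z, Y} = {X, Y, Z}" by auto
    show ?thesis
      by (rule half[of X Z Y, unfolded e, OF _ m \<tau> that abd(2,1)])
        (use t abd(3) in \<open>simp_all add: tri_perm(1)[of X Z Y] dist_commute\<close>)
  qed
  ultimately show ?thesis by (simp add: corner_def)
qed

lemma dist2_affine:
  fixes P a b :: point
  shows "(dist (P + x *\<^sub>R a + y *\<^sub>R b) (P + x' *\<^sub>R a + y' *\<^sub>R b))\<^sup>2 =
    (x' - x)\<^sup>2 * (a \<bullet> a) + 2 * (x' - x) * (y' - y) * (a \<bullet> b) + (y' - y)\<^sup>2 * (b \<bullet> b)"
  unfolding dist2_eq inner_vec2 by (simp add: power2_eq_square algebra_simps)

lemma leg_flush:
  assumes t: "tri P Q R \<noteq> 0" and iso: "dist P Q = dist P R"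
    and tX: "tri X Y Z \<noteq> 0" and m: "min_isosceles_container (convex hull {X, Y, Z}) (convex hull {P, Q, R})"
    and X: "X = P + x *\<^sub>R (Q - P)" and Y: "Y = P + y *\<^sub>R (Q - P)"
    and Z: "Z = P + p *\<^sub>R (Q - P) + r *\<^sub>R (R - P)"
    and xy: "0 \<le> x" "x < y" "y \<le> 1" and pr: "0 \<le> p" "0 \<le> r" "p + r \<le> 1"
    and ti: "x = 0 \<or> p = 0" "y = 1 \<or> p + r = 1"
  shows "special {X, Y, Z} (convex hull {P, Q, R})"
proof -
  define a b where "a = Q - P" and "b = R - P"
  define L where "L = a \<bullet> a"
  have L: "0 < L" using tri_neqD[OF t] by (auto simp: L_def a_def)
  have "(dist P R)\<^sup>2 = b \<bullet> b" "(dist P Q)\<^sup>2 = a \<bullet> a"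
    by (simp_all add: a_def b_def dist_norm power2_norm_eq_inner norm_minus_commute[of P])
  then have bb: "b \<bullet> b = L" using iso by (simp add: L_def)
  define c where "c = (a \<bullet> b) / L"
  have ab: "a \<bullet> b = L * c" using L by (simp add: c_def)
  have tab: "tri P Q R = a$1 * b$2 - a$2 * b$1" by (simp add: tri_def a_def b_def algebra_simps)
  \<comment> \<open>Lagrange's identity: non-degeneracy puts the cosine \<open>c\<close> of the apex
    angle strictly between -1 and 1.\<close>
  have "(a \<bullet> b)\<^sup>2 + (tri P Q R)\<^sup>2 = (a \<bullet> a) * (b \<bullet> b)"
    unfolding tab inner_vec2 by (simp add: power2_eq_square algebra_simps)
  then have "L\<^sup>2 * c\<^sup>2 + (tri P Q R)\<^sup>2 = L\<^sup>2" by (simp add: ab bb L_def[symmetric] power2_eq_square algebra_simps)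
  then have "L\<^sup>2 * c\<^sup>2 < L\<^sup>2 * 1" using t by (smt (verit) zero_less_power2)
  then have "c\<^sup>2 < 1" using L by simp
  then have c: "-1 < c" "c < 1" by (auto simp: power2_less_1_iff abs_less_iff abs_square_less_1)
  have XYZ: "X = P + x *\<^sub>R a + 0 *\<^sub>R b" "Y = P + y *\<^sub>R a + 0 *\<^sub>R b" "Z = P + p *\<^sub>R a + r *\<^sub>R b"
    by (simp_all add: X Y Z a_def b_def)
  have tri: "tri X Y Z = (y - x) * r * tri P Q R"
    unfolding XYZ tab by (simp add: tri_def algebra_simps)
  then have r: "0 < r" using tX pr by (cases "r = 0") auto
  define \<tau> where "\<tau> = 1 / ((y - x) * r)"
  have k: "0 < (y - x) * r" using xy r by simp
  have \<tau>: "(y - x) * r * \<tau> = 1" using xy(2) r by (simp add: \<tau>_def)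
  have ar: "area (convex hull {P, Q, R}) = \<tau> * area (convex hull {X, Y, Z})"
    using xy(2) r by (auto simp: area_triangle tri \<tau>_def abs_mult)
  have D: "(dist X Y)\<^sup>2 = L * (y-x)\<^sup>2"
    and E: "(dist X Z)\<^sup>2 = L * ((p-x)\<^sup>2 + 2*(p-x)*r*c + r\<^sup>2)"
    and F: "(dist Y Z)\<^sup>2 = L * ((y-p)\<^sup>2 - 2*(y-p)*r*c + r\<^sup>2)"
    unfolding XYZ dist2_affine ab bb L_def[symmetric] by (simp_all add: power2_eq_square algebra_simps)
  note cX = min_corner[OF tX m L ar D E F]
  have cZ: "corner \<tau> ((p-x)\<^sup>2 + 2*(p-x)*r*c + r\<^sup>2) ((y-p)\<^sup>2 - 2*(y-p)*r*c + r\<^sup>2) ((y-x)\<^sup>2)"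
    using min_corner[of Z X Y "convex hull {P, Q, R}" L \<tau>] tX m L ar D E F
    by (simp add: insert_commute dist_commute tri_perm(4)[of Z X Y])
  have disj: "x = 0 \<and> y = 1 \<and> (p = 0 \<or> p + r = 1) \<or> x = 0 \<and> p = 0 \<and> r = 1"
    by (rule leg_algebra[OF xy pr(1) r pr(3) c ti \<tau> refl refl refl cX cZ])
  have nab: "norm a = sqrt L" "norm b = sqrt L" by (simp_all add: norm_eq_sqrt_inner bb L_def)
  have dL: "dist P (P + s *\<^sub>R a) = s * sqrt L" "dist P (P + s *\<^sub>R b) = s * sqrt L" if "0 \<le> s" for s
    using that by (simp_all add: dist_norm nab)
  have sL: "0 < sqrt L" using L by simp
  \<comment> \<open>\<open>Z\<close> on the other leg gives the first kind with legs from
    \<open>X Y\<close>; \<open>Z\<close> on the base gives the second kind; \<open>Z = R\<close>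
    with \<open>Y\<close> on the leg gives the first kind with the roles of \<open>Y\<close> and
    \<open>Z\<close> exchanged.\<close>
  from disj consider "x = 0" "y = 1" "p = 0" | "x = 0" "y = 1" "p + r = 1" | "x = 0" "p = 0" "r = 1" by auto
  then show ?thesis
  proof cases
    case 1
    then have xyz: "X = P" "Y = Q" "Z = P + r *\<^sub>R b" using X Y XYZ(3) by simp_all
    have "dist X Z = r * sqrt L" "dist X Y = sqrt L"
      using dL(2)[of r] dL(1)[of 1] r by (simp_all add: xyz a_def)
    moreover have "leg_ext X Y Z = R"
      unfolding leg_ext_def calculation using sL r by (simp add: xyz b_def)
    moreover have "r * sqrt L \<le> 1 * sqrt L" using sL 1 pr by (intro mult_right_mono) auto
    ultimately show ?thesis using xyz by (intro special_legI[of X Y Z R]) auto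
  next
    case 2
    then have p: "p = 1 - r" by simp
    have xyz: "X = P" "Y = Q" "Z = Q + r *\<^sub>R (R - Q)" using 2 X Y Z unfolding p by (simp_all add: algebra_simps)
    have D': "(dist X Y)\<^sup>2 = L" using D 2 by simp
    have E': "(dist X Z)\<^sup>2 = L - L * (2 * r * (1 - r) * (1 - c))"
      using E 2(1) unfolding p by (simp add: power2_eq_square algebra_simps)
    have F': "(dist Y Z)\<^sup>2 = L * (2 * r\<^sup>2 * (1 - c))"
      using F 2(2) unfolding p by (simp add: power2_eq_square algebra_simps)
    have "1 + (2 * r * (1 - r) * (1 - c)) / (2 * r\<^sup>2 * (1 - c)) = 1 / r"
      using c r by (simp add: power2_eq_square field_simps)
    then have s: "1 + ((dist X Y)\<^sup>2 - (dist X Z)\<^sup>2) / (dist Y Z)\<^sup>2 = 1 / r"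
      unfolding D' E' F' using L by simp
    have "base_ext X Y Z = R"
      unfolding base_ext_def s using r by (simp add: xyz)
    moreover have "0 \<le> L * (2 * r * (1 - r) * (1 - c))" using L c(2) r pr(1) p by simp
    then have "(dist X Z)\<^sup>2 \<le> (dist X Y)\<^sup>2" unfolding D' E' by linarith
    then have "dist X Z \<le> dist X Y" by (rule power2_le_imp_le) simp
    ultimately show ?thesis using xyz by (intro special_baseI[of X Y Z R]) auto
  next
    case 3
    then have xyz: "X = P" "Z = R" "Y = P + y *\<^sub>R a" using X Y Z XYZ(2) by simp_all
    have y: "0 < y" using xy by simp
    have "dist X Y = y * sqrt L" "dist X Z = sqrt L"
      using dL(2)[of 1] dL(1)[of y] y by (simp_all add: xyz b_def)
    moreover have "leg_ext X Z Y = Q"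
      unfolding leg_ext_def calculation using sL y by (simp add: xyz a_def)
    moreover have "y * sqrt L \<le> 1 * sqrt L" using sL xy by (intro mult_right_mono) auto
    ultimately show ?thesis using xyz by (intro special_legI[of X Z Y Q]) auto
  qed
qed

lemma base_flush:
  assumes t: "tri P Q R \<noteq> 0" and iso: "dist P Q = dist P R"
    and tX: "tri X Y Z \<noteq> 0" and m: "min_isosceles_container (convex hull {X, Y, Z}) (convex hull {P, Q, R})"
    and X: "X = Q + x *\<^sub>R (R - Q)" and Y: "Y = Q + y *\<^sub>R (R - Q)"
    and Z: "Z = Q + p *\<^sub>R (R - Q) + r *\<^sub>R (P - Q)"
    and xy: "0 \<le> x" "x < y" "y \<le> 1" and pr: "0 \<le> p" "0 \<le> r" "p + r \<le> 1"
    and ti: "x = 0 \<or> p = 0" "y = 1 \<or> p + r = 1"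
  shows "special {X, Y, Z} (convex hull {P, Q, R})"
proof -
  define a b where "a = R - Q" and "b = P - Q"
  define L where "L = a \<bullet> a"
  have L: "0 < L" using tri_neqD[OF t] by (auto simp: L_def a_def)
  have "(dist P R)\<^sup>2 = (b - a) \<bullet> (b - a)" "(dist P Q)\<^sup>2 = b \<bullet> b"
    by (simp_all add: a_def b_def dist_norm power2_norm_eq_inner)
  then have ab: "a \<bullet> b = L / 2" using iso by (simp add: L_def inner_diff inner_commute)
  \<comment> \<open>The squared height of the container over its base, relative to the squared base
    length \<open>L\<close>. The preceding a \<bullet> b = L / 2 says that the apex lies above the
    midpoint of the base.\<close>
  define h where "h = (b \<bullet> b) / L - 1/4"
  have bb: "b \<bullet> b = L * (h + 1/4)" using L by (simp add: h_def)
  have tab: "tri P Q R = a$1 * b$2 - a$2 * b$1" by (simp add: tri_def a_def b_def algebra_simps)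
  have XYZ: "X = Q + x *\<^sub>R a + 0 *\<^sub>R b" "Y = Q + y *\<^sub>R a + 0 *\<^sub>R b" "Z = Q + p *\<^sub>R a + r *\<^sub>R b"
    by (simp_all add: X Y Z a_def b_def)
  have tri: "tri X Y Z = (y - x) * r * tri P Q R"
    unfolding XYZ tab by (simp add: tri_def algebra_simps)
  then have r: "0 < r" using tX pr by (cases "r = 0") auto
  define \<tau> where "\<tau> = 1 / ((y - x) * r)"
  have k: "0 < (y - x) * r" using xy r by simp
  have \<tau>: "(y - x) * r * \<tau> = 1" using xy(2) r by (simp add: \<tau>_def)
  have ar: "area (convex hull {P, Q, R}) = \<tau> * area (convex hull {X, Y, Z})"
    using xy(2) r by (auto simp: area_triangle tri \<tau>_def abs_mult)
  have D: "(dist X Y)\<^sup>2 = L * (y-x)\<^sup>2"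
    and E: "(dist X Z)\<^sup>2 = L * ((p+r/2-x)\<^sup>2 + r\<^sup>2 * h)"
    and F: "(dist Y Z)\<^sup>2 = L * ((p+r/2-y)\<^sup>2 + r\<^sup>2 * h)"
    unfolding XYZ dist2_affine ab bb L_def[symmetric] by (simp_all add: power2_eq_square algebra_simps)
  have cZ: "corner \<tau> ((p+r/2-x)\<^sup>2 + r\<^sup>2 * h) ((p+r/2-y)\<^sup>2 + r\<^sup>2 * h) ((y-x)\<^sup>2)"
    using min_corner[of Z X Y "convex hull {P, Q, R}" L \<tau>] tX m L ar D E F
    by (simp add: insert_commute dist_commute tri_perm(4)[of Z X Y])
  have disj: "p = 0 \<and> r = 1 \<and> (x = 0 \<or> y = 1)"
    by (rule base_algebra[OF xy pr(1) r pr(3) ti \<tau> refl refl refl cZ])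
  then have Zp: "Z = P" using Z by simp
  from disj consider "x = 0" | "y = 1" by auto
  then show ?thesis
  proof cases
    case 1
    then have xq: "X = Q" using X by simp
    have E': "(dist Z X)\<^sup>2 = L * (1/4 + h)" using E 1 disj by (simp add: power2_eq_square dist_commute)
    have F': "(dist Z Y)\<^sup>2 = L * (1/4 + h) - L * (y * (1 - y))"
      using F disj by (simp add: power2_eq_square dist_commute algebra_simps)
    have "1 + (y * (1 - y)) / y\<^sup>2 = 1 / y" using xy(1,2) 1 by (simp add: power2_eq_square field_simps)
    then have "1 + ((dist Z X)\<^sup>2 - (dist Z Y)\<^sup>2) / (dist X Y)\<^sup>2 = 1 / y"
      unfolding D E' F' using L 1 by simp
    then have "base_ext Z X Y = R"
      unfolding base_ext_def using xy 1 by (simp add: xq Y)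
    moreover have "0 \<le> L * (y * (1 - y))" using L xy(1,2,3) by simp
    then have "(dist Z Y)\<^sup>2 \<le> (dist Z X)\<^sup>2" unfolding E' F' by linarith
    then have "dist Z Y \<le> dist Z X" by (rule power2_le_imp_le) simp
    ultimately show ?thesis using xq Zp by (intro special_baseI[of Z X Y R]) auto
  next
    case 2
    then have yr: "Y = R" using Y by simp
    have F': "(dist Z Y)\<^sup>2 = L * (1/4 + h)" using F 2 disj by (simp add: power2_eq_square dist_commute)
    have E': "(dist Z X)\<^sup>2 = L * (1/4 + h) - L * (x * (1 - x))"
      using E disj by (simp add: power2_eq_square dist_commute algebra_simps)
    have D': "(dist Y X)\<^sup>2 = L * (1 - x)\<^sup>2" using D 2 by (simp add: dist_commute)
    have "1 + (x * (1 - x)) / (1 - x)\<^sup>2 = 1 / (1 - x)"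
      using xy(2) 2 by (simp add: power2_eq_square divide_simps)
    then have s: "1 + ((dist Z Y)\<^sup>2 - (dist Z X)\<^sup>2) / (dist Y X)\<^sup>2 = 1 / (1 - x)"
      unfolding D' E' F' using L by simp
    have XR: "X - R = (1 - x) *\<^sub>R (Q - R)" by (simp add: X algebra_simps)
    have "base_ext Z Y X = Q"
      unfolding base_ext_def s unfolding yr XR using xy(2) 2 by simp
    moreover have "0 \<le> L * (x * (1 - x))" using L xy(1,2,3) by simp
    then have "(dist Z X)\<^sup>2 \<le> (dist Z Y)\<^sup>2" unfolding E' F' by linarith
    then have "dist Z X \<le> dist Z Y" by (rule power2_le_imp_le) simp
    ultimately show ?thesis using yr Zp by (intro special_baseI[of Z Y X Q]) auto
  qed
qed

section \<open>Minimum containers are flush\<close>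

definition rot :: "real \<Rightarrow> point \<Rightarrow> point" where
  "rot t V = (\<chi> i. if i = 1 then cos t * V$1 - sin t * V$2 else sin t * V$1 + cos t * V$2)"

lemma rot_nth [simp]:
  "rot t V $ 1 = cos t * V$1 - sin t * V$2" "rot t V $ 2 = sin t * V$1 + cos t * V$2"
  by (simp_all add: rot_def)

lemma rot_lincomb: "rot t (u *\<^sub>R P + v *\<^sub>R Q + w *\<^sub>R R) = u *\<^sub>R rot t P + v *\<^sub>R rot t Q + w *\<^sub>R rot t R"
  by (simp add: vec2_eq_iff algebra_simps)

lemma rot_inverse: "rot (- t) (rot t V) = V"
proof -
  have "(sin t)\<^sup>2 + (cos t)\<^sup>2 = 1" by simp
  then have "cos t * (cos t * V$1 - sin t * V$2) + sin t * (sin t * V$1 + cos t * V$2) = V$1"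
    "cos t * (sin t * V$1 + cos t * V$2) - sin t * (cos t * V$1 - sin t * V$2) = V$2" by algebra+
  then show ?thesis by (simp add: vec2_eq_iff)
qed

lemma dist_rot: "dist (rot t V) (rot t W) = dist V W"
proof -
  have "(sin t)\<^sup>2 + (cos t)\<^sup>2 = 1" by simp
  then have "(dist (rot t V) (rot t W))\<^sup>2 = (dist V W)\<^sup>2"
    unfolding dist2_eq rot_nth by algebra
  then show ?thesis by simp
qed

lemma tri_rot: "tri (rot t P) (rot t Q) (rot t R) = tri P Q R"
proof -
  have "(sin t)\<^sup>2 + (cos t)\<^sup>2 = 1" by simp
  then show ?thesis unfolding tri_def rot_nth by algebra
qed

text \<open>Invariant under relabelling the vertices, so an argument about one side applies to all
  three, wherever the apex is.\<close>

definition iso3 :: "point \<Rightarrow> point \<Rightarrow> point \<Rightarrow> bool" where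
  "iso3 P Q R \<longleftrightarrow> dist P Q = dist P R \<or> dist Q R = dist Q P \<or> dist R P = dist R Q"

lemma iso3_container:
  assumes "tri P Q R \<noteq> 0" "iso3 P Q R" "T \<subseteq> convex hull {P, Q, R}"
  shows "isosceles_container T (convex hull {P, Q, R})"
proof -
  have e: "{P, Q, R} = {Q, R, P}" "{P, Q, R} = {R, P, Q}" by auto
  have t: "tri Q R P \<noteq> 0" "tri R P Q \<noteq> 0" using assms(1) by (simp_all add: tri_def algebra_simps)
  consider "dist P Q = dist P R" | "dist Q R = dist Q P" | "dist R P = dist R Q"
    using assms(2) by (auto simp: iso3_def)
  then show ?thesis
  proof cases
    case 1 then show ?thesis unfolding isosceles_container_iff using assms by blast
  next
    case 2 then show ?thesis unfolding isosceles_container_iff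
      by (intro exI[of _ Q] exI[of _ R] exI[of _ P] conjI) (use t(1) assms(3) e(1) in simp_all)
  next
    case 3 then show ?thesis unfolding isosceles_container_iff
      by (intro exI[of _ R] exI[of _ P] exI[of _ Q] conjI) (use t(2) assms(3) e(2) in simp_all)
  qed
qed

text \<open>The points with barycentric coordinates at least \<open>m1\<close>, \<open>m2\<close>,
  \<open>m3\<close> form a homothetic copy of \<open>P Q R\<close> of ratio 1 - (m1 + m2 + m3) < 1.
  It contains the rotated set, and rotating it back gives a smaller container of the original
  one.\<close>

lemma container_shrink:
  assumes t: "tri P Q R \<noteq> 0" and iso: "iso3 P Q R"
    and S: "X \<in> S" "Y \<in> S" "X \<noteq> Y"
    and b: "\<And>V. V \<in> S \<Longrightarrow> m1 \<le> bary P Q R (rot \<theta> V)" "\<And>V. V \<in> S \<Longrightarrow> m2 \<le> bary Q R P (rot \<theta> V)"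
      "\<And>V. V \<in> S \<Longrightarrow> m3 \<le> bary R P Q (rot \<theta> V)"
    and m: "0 < m1 + m2 + m3"
  shows "\<exists>T'. isosceles_container (convex hull S) T' \<and> area T' < area (convex hull {P, Q, R})"
proof -
  define l where "l = 1 - (m1 + m2 + m3)"
  note bs = bary_sum[OF t]
  have "0 \<le> l" using b[OF S(1)] bs[of "rot \<theta> X"] by (simp add: l_def)
  \<comment> \<open>For \<open>l = 0\<close> the lower bounds would fix all barycentric coordinates,
    collapsing \<open>S\<close> to a single point.\<close>
  moreover have "l \<noteq> 0"
  proof
    assume "l = 0"
    then have *: "bary P Q R (rot \<theta> V) = m1 \<and> bary Q R P (rot \<theta> V) = m2 \<and> bary R P Q (rot \<theta> V) = m3"
      if "V \<in> S" for V
      using b[OF that] bs[of "rot \<theta> V"] by (auto simp: l_def)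
    have "rot \<theta> V = m1 *\<^sub>R P + m2 *\<^sub>R Q + m3 *\<^sub>R R" if "V \<in> S" for V
      by (rule trans[OF bary_rep[OF t]]) (simp add: *[OF that])
    then have "rot \<theta> X = rot \<theta> Y" using S by simp
    then have "rot (- \<theta>) (rot \<theta> X) = rot (- \<theta>) (rot \<theta> Y)" by simp
    then have "X = Y" unfolding rot_inverse .
    then show False using S by simp
  qed
  ultimately have l: "0 < l" "l < 1" using m by (auto simp: l_def)
  define s where "s = m1 *\<^sub>R P + m2 *\<^sub>R Q + m3 *\<^sub>R R"
  define f where "f A = rot (- \<theta>) (l *\<^sub>R A + s)" for A
  have df: "dist (f A) (f B) = l * dist A B" for A B
    unfolding f_def dist_rot using l by (simp add: dist_norm flip: scaleR_diff_right)
  have tf: "tri (f P) (f Q) (f R) = l\<^sup>2 * tri P Q R"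
    unfolding f_def tri_rot by (simp add: tri_def power2_eq_square algebra_simps)
  have "iso3 (f P) (f Q) (f R)" using iso l by (auto simp: iso3_def df)
  moreover have "tri (f P) (f Q) (f R) \<noteq> 0" using t l by (simp add: tf)
  moreover have "convex hull S \<subseteq> convex hull {f P, f Q, f R}"
  proof (intro hull_minimal convex_convex_hull subsetI)
    fix V assume V: "V \<in> S"
    define u v w where "u = (bary P Q R (rot \<theta> V) - m1) / l" "v = (bary Q R P (rot \<theta> V) - m2) / l"
      "w = (bary R P Q (rot \<theta> V) - m3) / l"
    have sum: "u + v + w = 1"
      using bs[of "rot \<theta> V"] l unfolding u_v_w_def by (simp add: l_def flip: add_divide_distrib)
    have lu: "l * u = bary P Q R (rot \<theta> V) - m1" "l * v = bary Q R P (rot \<theta> V) - m2"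
      "l * w = bary R P Q (rot \<theta> V) - m3" using l by (simp_all add: u_v_w_def)
    have "u *\<^sub>R (l *\<^sub>R P + s) + v *\<^sub>R (l *\<^sub>R Q + s) + w *\<^sub>R (l *\<^sub>R R + s) =
      (l * u) *\<^sub>R P + (l * v) *\<^sub>R Q + (l * w) *\<^sub>R R + (u + v + w) *\<^sub>R s"
      by (simp add: algebra_simps)
    also have "\<dots> = bary P Q R (rot \<theta> V) *\<^sub>R P + bary Q R P (rot \<theta> V) *\<^sub>R Q + bary R P Q (rot \<theta> V) *\<^sub>R R"
      unfolding sum lu s_def by (simp add: algebra_simps)
    also have "\<dots> = rot \<theta> V" by (rule bary_rep[OF t, symmetric])
    finally have "V = u *\<^sub>R f P + v *\<^sub>R f Q + w *\<^sub>R f R"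
      unfolding f_def rot_lincomb[symmetric] by (simp only: rot_inverse)
    moreover have "0 \<le> u" "0 \<le> v" "0 \<le> w" using b[OF V] l by (simp_all add: u_v_w_def)
    ultimately show "V \<in> convex hull {f P, f Q, f R}" using sum by (intro in_hull_3I)
  qed
  ultimately have "isosceles_container (convex hull S) (convex hull {f P, f Q, f R})"
    by (intro iso3_container)
  moreover have "area (convex hull {f P, f Q, f R}) < area (convex hull {P, Q, R})"
  proof -
    have "l\<^sup>2 < 1" using l by (simp add: power_less_one_iff)
    then have "l\<^sup>2 * \<bar>tri P Q R\<bar> < 1 * \<bar>tri P Q R\<bar>" using t by (intro mult_strict_right_mono) auto
    then show ?thesis by (simp add: area_triangle tf abs_mult)
  qed
  ultimately show ?thesis by blast
qed

text \<open>A side that misses \<open>T\<close> can be pushed inwards parallel to itself: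
  \<open>container_shrink\<close> applies with angle 0 and bounds \<open>m1\<close>, 0, 0, where
  \<open>m1\<close> > 0 is the least coordinate.\<close>

lemma min_tight:
  assumes t: "tri P Q R \<noteq> 0" and iso: "iso3 P Q R" and tX: "tri X Y Z \<noteq> 0"
    and m: "min_isosceles_container (convex hull {X, Y, Z}) (convex hull {P, Q, R})"
  shows "\<exists>V\<in>{X, Y, Z}. bary P Q R V = 0"
proof (rule ccontr)
  assume n: "\<not> ?thesis"
  have sub: "convex hull {X, Y, Z} \<subseteq> convex hull {P, Q, R}"
    using m by (auto simp: min_isosceles_container_def isosceles_container_def)
  have V: "V \<in> convex hull {P, Q, R}" if "V \<in> {X, Y, Z}" for V
    using sub hull_inc[OF that, of convex] by blast
  have rot0: "rot 0 V = V" for V by (simp add: vec2_eq_iff)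
  have e: "{P, Q, R} = {Q, R, P}" "{P, Q, R} = {R, P, Q}" by auto
  have t': "tri Q R P \<noteq> 0" "tri R P Q \<noteq> 0" using t by (simp_all add: tri_def algebra_simps)
  define m1 where "m1 = Min (bary P Q R ` {X, Y, Z})"
  have "m1 \<in> bary P Q R ` {X, Y, Z}" unfolding m1_def by (intro Min_in) auto
  then obtain W where "W \<in> {X, Y, Z}" "m1 = bary P Q R W" by blast
  then have "0 < m1" using n bary_nonneg[OF t V] by (metis less_eq_real_def)
  moreover have "m1 \<le> bary P Q R V" if "V \<in> {X, Y, Z}" for V
    unfolding m1_def using that by (intro Min_le) auto
  moreover have "0 \<le> bary Q R P V" "0 \<le> bary R P Q V" if "V \<in> {X, Y, Z}" for V
    using bary_nonneg[OF t'(1)] bary_nonneg[OF t'(2)] V[OF that] e by auto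
  ultimately have "\<exists>T'. isosceles_container (convex hull {X, Y, Z}) T' \<and> area T' < area (convex hull {P, Q, R})"
    using tri_neqD[OF tX] by (intro container_shrink[OF t iso, of X _ Y m1 0 0 0]) (simp_all add: rot0)
  then show False using min_containerD[OF m] by force
qed

text \<open>The two rotated copies of \<open>V\<close> add up to 2 cos \<theta> times
  \<open>V\<close>, and \<open>bary\<close> is affine; its constant term produces the value at the
  origin, the centre of rotation.\<close>

lemma bary_rot_sum:
  "bary P Q R (rot \<theta> V) + bary P Q R (rot (- \<theta>) V) =
    2 * cos \<theta> * bary P Q R V + (2 - 2 * cos \<theta>) * bary P Q R 0"
proof -
  have "tri (rot \<theta> V) Q R + tri (rot (- \<theta>) V) Q R = 2 * cos \<theta> * tri V Q R + (2 - 2 * cos \<theta>) * tri 0 Q R"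
    by (simp add: tri_def algebra_simps)
  then show ?thesis by (simp add: bary_def flip: add_divide_distrib)
qed

text \<open>A strict minimum over a finite set persists under small perturbations, so the same
  vertex stays extremal for both directions of rotation.\<close>

lemma bary_rot_eventually:
  assumes "finite S" "\<And>W. W \<in> S \<Longrightarrow> W \<noteq> V \<Longrightarrow> bary P Q R V < bary P Q R W"
  shows "eventually (\<lambda>\<theta>. \<forall>W\<in>S. bary P Q R (rot \<theta> V) \<le> bary P Q R (rot \<theta> W)) (nhds 0)"
proof (intro eventually_ball_finite assms(1) ballI)
  fix W assume W: "W \<in> S"
  show "eventually (\<lambda>\<theta>. bary P Q R (rot \<theta> V) \<le> bary P Q R (rot \<theta> W)) (nhds 0)"
  proof (cases "W = V")
    case False
    define g where "g \<theta> = bary P Q R (rot \<theta> W) - bary P Q R (rot \<theta> V)" for \<theta>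
    have rot0: "rot 0 V = V" for V by (simp add: vec2_eq_iff)
    have "isCont g 0"
      unfolding g_def bary_def tri_def rot_nth divide_inverse by (intro continuous_intros)
    then have "(g \<longlongrightarrow> g 0) (nhds 0)" unfolding isCont_def tendsto_at_iff_tendsto_nhds .
    moreover have "0 < g 0" using assms(2)[OF W False] by (simp add: g_def rot0)
    ultimately have "eventually (\<lambda>\<theta>. 0 < g \<theta>) (nhds 0)" by (rule order_tendstoD)
    then show ?thesis by eventually_elim (simp add: g_def)
  qed simp
qed

lemma min_flush:
  assumes t: "tri P Q R \<noteq> 0" and iso: "iso3 P Q R" and tX: "tri X Y Z \<noteq> 0"
    and m: "min_isosceles_container (convex hull {X, Y, Z}) (convex hull {P, Q, R})"
  shows "\<exists>V\<in>{X, Y, Z}. \<exists>W\<in>{X, Y, Z}. V \<noteq> W \<and>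
    (bary P Q R V = 0 \<and> bary P Q R W = 0 \<or> bary Q R P V = 0 \<and> bary Q R P W = 0 \<or>
     bary R P Q V = 0 \<and> bary R P Q W = 0)"
proof (rule ccontr)
  let ?S = "{X, Y, Z}"
  assume n: "\<not> ?thesis"
  have sub: "convex hull ?S \<subseteq> convex hull {P, Q, R}"
    using m by (auto simp: min_isosceles_container_def isosceles_container_def)
  have V: "V \<in> convex hull {P, Q, R}" if "V \<in> ?S" for V
    using sub hull_inc[OF that, of convex] by blast
  have e: "{P, Q, R} = {Q, R, P}" "{P, Q, R} = {R, P, Q}" by auto
  have t': "tri Q R P \<noteq> 0" "tri R P Q \<noteq> 0" using t by (simp_all add: tri_def algebra_simps)
  have iso': "iso3 Q R P" "iso3 R P Q" using iso by (auto simp: iso3_def)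
  obtain V1 where V1: "V1 \<in> ?S" "bary P Q R V1 = 0" using min_tight[OF t iso tX m] by blast
  obtain V2 where V2: "V2 \<in> ?S" "bary Q R P V2 = 0" using min_tight[OF t'(1) iso'(1) tX m[unfolded e(1)]] by blast
  obtain V3 where V3: "V3 \<in> ?S" "bary R P Q V3 = 0" using min_tight[OF t'(2) iso'(2) tX m[unfolded e(2)]] by blast
  \<comment> \<open>Without a flush side, the vertex touching a given side is the only one there,
    hence the strict minimizer of that coordinate.\<close>
  have p1: "bary P Q R V1 < bary P Q R W" if "W \<in> ?S" "W \<noteq> V1" for W
    using n V1 that bary_nonneg[OF t V[OF that(1)]] by (metis less_eq_real_def)
  have p2: "bary Q R P V2 < bary Q R P W" if "W \<in> ?S" "W \<noteq> V2" for W
    using n V2 that bary_nonneg[OF t'(1) V[OF that(1), unfolded e(1)]] by (metis less_eq_real_def)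
  have p3: "bary R P Q V3 < bary R P Q W" if "W \<in> ?S" "W \<noteq> V3" for W
    using n V3 that bary_nonneg[OF t'(2) V[OF that(1), unfolded e(2)]] by (metis less_eq_real_def)
  define E where "E \<theta> \<longleftrightarrow> (\<forall>W\<in>?S. bary P Q R (rot \<theta> V1) \<le> bary P Q R (rot \<theta> W)) \<and>
    (\<forall>W\<in>?S. bary Q R P (rot \<theta> V2) \<le> bary Q R P (rot \<theta> W)) \<and>
    (\<forall>W\<in>?S. bary R P Q (rot \<theta> V3) \<le> bary R P Q (rot \<theta> W))" for \<theta>
  have "eventually E (nhds 0)"
    unfolding E_def by (intro eventually_conj bary_rot_eventually p1 p2 p3) auto
  then obtain d where d: "0 < d" "\<And>\<theta>. dist \<theta> 0 < d \<Longrightarrow> E \<theta>" by (auto simp: eventually_nhds_metric)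
  \<comment> \<open>The cap 1 keeps \<theta> inside the interval from 0 to \<pi>, where cos \<theta>
    < 1.\<close>
  define \<theta> where "\<theta> = min (d / 2) 1"
  have \<theta>: "0 < \<theta>" "\<theta> < d" "\<theta> \<le> 1" using d by (auto simp: \<theta>_def)
  have E: "E \<theta>" "E (- \<theta>)" using d(2) \<theta> by auto
  have "cos \<theta> < cos 0" using \<theta> pi_ge_two by (intro cos_monotone_0_pi) auto
  then have c: "0 < 2 - 2 * cos \<theta>" by simp
  \<comment> \<open>\<open>1 - M x\<close> is the scale of the copy circumscribed about
    \<open>T\<close> turned by \<open>x\<close>. The constant terms of the three coordinates add up
    to 1, so M \<theta> + M (-\<theta>) = 2 - 2 cos \<theta> > 0.\<close>
  define M where "M x = bary P Q R (rot x V1) + bary Q R P (rot x V2) + bary R P Q (rot x V3)" for x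
  have "M \<theta> + M (- \<theta>) = (2 - 2 * cos \<theta>) * (bary P Q R 0 + bary Q R P 0 + bary R P Q 0)"
    using bary_rot_sum[of P Q R \<theta> V1] bary_rot_sum[of Q R P \<theta> V2] bary_rot_sum[of R P Q \<theta> V3]
    by (simp add: M_def V1 V2 V3 distrib_left)
  then have "0 < M \<theta> + M (- \<theta>)" using c bary_sum[OF t] by simp
  then consider "0 < M \<theta>" | "0 < M (- \<theta>)" by linarith
  then have "\<exists>x. E x \<and> 0 < M x" using E by cases blast+
  then obtain x where x: "E x" "0 < M x" by blast
  have "\<exists>T'. isosceles_container (convex hull ?S) T' \<and> area T' < area (convex hull {P, Q, R})"
    by (rule container_shrink[OF t iso, of X _ Y "bary P Q R (rot x V1)" x "bary Q R P (rot x V2)" "bary R P Q (rot x V3)"])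
      (use x tri_neqD[OF tX] in \<open>auto simp: E_def M_def\<close>)
  then show False using min_containerD[OF m] by force
qed

lemma bary_swap: "bary P R Q V = bary P Q R V"
  using tri_perm(1)[of V Q R] tri_perm(1)[of P Q R] by (simp add: bary_def)

lemma bary_rep_edge:
  assumes "tri P Q R \<noteq> 0"
  shows "V = P + bary Q R P V *\<^sub>R (Q - P) + bary R P Q V *\<^sub>R (R - P)"
proof -
  have e: "bary P Q R V = 1 - bary Q R P V - bary R P Q V" using bary_sum[OF assms, of V] by simp
  show ?thesis by (rule trans[OF bary_rep[OF assms]]) (simp add: e algebra_simps)
qed

section \<open>From a flush side to a special container\<close>

lemma min_leg_special:
  assumes t: "tri P Q R \<noteq> 0" and iso: "dist P Q = dist P R" and tX: "tri X Y Z \<noteq> 0"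
    and m: "min_isosceles_container (convex hull {X, Y, Z}) (convex hull {P, Q, R})"
    and f: "bary R P Q X = 0" "bary R P Q Y = 0"
  shows "special {X, Y, Z} (convex hull {P, Q, R})"
proof -
  have *: "special {X, Y, Z} (convex hull {P, Q, R})"
    if tX: "tri X Y Z \<noteq> 0" and m: "min_isosceles_container (convex hull {X, Y, Z}) (convex hull {P, Q, R})"
    and f: "bary R P Q X = 0" "bary R P Q Y = 0" and lt: "bary Q R P X < bary Q R P Y" for X Y
  proof -
    have e: "{P, Q, R} = {Q, R, P}" "{P, Q, R} = {R, P, Q}" by auto
    have t': "tri Q R P \<noteq> 0" "tri R P Q \<noteq> 0" using t by (simp_all add: tri_def algebra_simps)
    have iso3: "iso3 P Q R" "iso3 Q R P" using iso by (auto simp: iso3_def)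
    have sub: "convex hull {X, Y, Z} \<subseteq> convex hull {P, Q, R}"
      using m by (auto simp: min_isosceles_container_def isosceles_container_def)
    have V: "V \<in> convex hull {P, Q, R}" if "V \<in> {X, Y, Z}" for V
      using sub hull_inc[OF that, of convex] by blast
    have nn: "0 \<le> bary P Q R V" "0 \<le> bary Q R P V" "0 \<le> bary R P Q V" if "V \<in> {X, Y, Z}" for V
      using bary_nonneg[OF t] bary_nonneg[OF t'(1)] bary_nonneg[OF t'(2)] V[OF that] e by auto
    note s = bary_sum[OF t]
    have tight: "\<exists>V\<in>{X, Y, Z}. bary P Q R V = 0" "\<exists>V\<in>{X, Y, Z}. bary Q R P V = 0"
      using min_tight[OF t iso3(1) tX m] min_tight[OF t'(1) iso3(2) tX m[unfolded e(1)]] by blast+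
    show ?thesis
    proof (rule leg_flush[OF t iso tX m])
      show "X = P + bary Q R P X *\<^sub>R (Q - P)" by (rule trans[OF bary_rep_edge[OF t]]) (simp add: f)
      show "Y = P + bary Q R P Y *\<^sub>R (Q - P)" by (rule trans[OF bary_rep_edge[OF t]]) (simp add: f)
      show "Z = P + bary Q R P Z *\<^sub>R (Q - P) + bary R P Q Z *\<^sub>R (R - P)" by (rule bary_rep_edge[OF t])
      show "0 \<le> bary Q R P X" "0 \<le> bary Q R P Z" "0 \<le> bary R P Q Z" using nn by auto
      show "bary Q R P Y \<le> 1" using nn(1)[of Y] s[of Y] f by simp
      show "bary Q R P Z + bary R P Q Z \<le> 1" using nn(1)[of Z] s[of Z] by simp
      show "bary Q R P X < bary Q R P Y" by (rule lt)
      \<comment> \<open>Some vertex touches the side \<open>P R\<close>; it is not \<open>Y\<close>,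
        whose coordinate exceeds that of \<open>X\<close>. For the side \<open>Q R\<close> it is
        \<open>X\<close> that is excluded.\<close>
      show "bary Q R P X = 0 \<or> bary Q R P Z = 0" using tight(2) lt nn(2)[of X] by auto
      show "bary Q R P Y = 1 \<or> bary Q R P Z + bary R P Q Z = 1"
        using tight(1) lt s[of X] s[of Y] s[of Z] nn(1)[of Y] f by auto
    qed
  qed
  have ne: "bary Q R P X \<noteq> bary Q R P Y"
  proof
    assume eq: "bary Q R P X = bary Q R P Y"
    have "X = P + bary Q R P X *\<^sub>R (Q - P)" "Y = P + bary Q R P Y *\<^sub>R (Q - P)"
      by (rule trans[OF bary_rep_edge[OF t]], simp add: f)+
    then have "X = Y" using eq by metis
    then show False using tri_neqD[OF tX] by simp
  qed
  have e: "{Y, X, Z} = {X, Y, Z}" by auto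
  show ?thesis
  proof (cases "bary Q R P X < bary Q R P Y")
    case True then show ?thesis using * tX m f by blast
  next
    case False
    then have "bary Q R P Y < bary Q R P X" using ne by simp
    moreover have "tri Y X Z \<noteq> 0" using tX tri_perm(2)[of Y X Z] by simp
    ultimately show ?thesis using *[of Y X] m f unfolding e by blast
  qed
qed

lemma min_base_special:
  assumes t: "tri P Q R \<noteq> 0" and iso: "dist P Q = dist P R" and tX: "tri X Y Z \<noteq> 0"
    and m: "min_isosceles_container (convex hull {X, Y, Z}) (convex hull {P, Q, R})"
    and f: "bary P Q R X = 0" "bary P Q R Y = 0"
  shows "special {X, Y, Z} (convex hull {P, Q, R})"
proof -
  have e: "{P, Q, R} = {Q, R, P}" "{P, Q, R} = {R, P, Q}" by auto
  have t': "tri Q R P \<noteq> 0" "tri R P Q \<noteq> 0" using t by (simp_all add: tri_def algebra_simps)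
  have *: "special {X, Y, Z} (convex hull {P, Q, R})"
    if tX: "tri X Y Z \<noteq> 0" and m: "min_isosceles_container (convex hull {X, Y, Z}) (convex hull {P, Q, R})"
    and f: "bary P Q R X = 0" "bary P Q R Y = 0" and lt: "bary R P Q X < bary R P Q Y" for X Y
  proof -
    have iso3: "iso3 R P Q" "iso3 Q R P" using iso by (auto simp: iso3_def)
    have sub: "convex hull {X, Y, Z} \<subseteq> convex hull {P, Q, R}"
      using m by (auto simp: min_isosceles_container_def isosceles_container_def)
    have V: "V \<in> convex hull {P, Q, R}" if "V \<in> {X, Y, Z}" for V
      using sub hull_inc[OF that, of convex] by blast
    have nn: "0 \<le> bary P Q R V" "0 \<le> bary Q R P V" "0 \<le> bary R P Q V" if "V \<in> {X, Y, Z}" for V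
      using bary_nonneg[OF t] bary_nonneg[OF t'(1)] bary_nonneg[OF t'(2)] V[OF that] e by auto
    note s = bary_sum[OF t]
    have tight: "\<exists>V\<in>{X, Y, Z}. bary R P Q V = 0" "\<exists>V\<in>{X, Y, Z}. bary Q R P V = 0"
      using min_tight[OF t'(2) iso3(1) tX m[unfolded e(2)]] min_tight[OF t'(1) iso3(2) tX m[unfolded e(1)]] by blast+
    show ?thesis
    proof (rule base_flush[OF t iso tX m])
      show "X = Q + bary R P Q X *\<^sub>R (R - Q)" by (rule trans[OF bary_rep_edge[OF t'(1)]]) (simp add: f)
      show "Y = Q + bary R P Q Y *\<^sub>R (R - Q)" by (rule trans[OF bary_rep_edge[OF t'(1)]]) (simp add: f)
      show "Z = Q + bary R P Q Z *\<^sub>R (R - Q) + bary P Q R Z *\<^sub>R (P - Q)" by (rule bary_rep_edge[OF t'(1)])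
      show "0 \<le> bary R P Q X" "0 \<le> bary R P Q Z" "0 \<le> bary P Q R Z" using nn by auto
      show "bary R P Q Y \<le> 1" using nn(2)[of Y] s[of Y] f by simp
      show "bary R P Q Z + bary P Q R Z \<le> 1" using nn(2)[of Z] s[of Z] by simp
      show "bary R P Q X < bary R P Q Y" by (rule lt)
      show "bary R P Q X = 0 \<or> bary R P Q Z = 0" using tight(1) lt nn(3)[of X] by auto
      show "bary R P Q Y = 1 \<or> bary R P Q Z + bary P Q R Z = 1"
        using tight(2) lt s[of X] s[of Y] s[of Z] nn(2)[of Y] f by auto
    qed
  qed
  have ne: "bary R P Q X \<noteq> bary R P Q Y"
  proof
    assume eq: "bary R P Q X = bary R P Q Y"
    have "X = Q + bary R P Q X *\<^sub>R (R - Q)" "Y = Q + bary R P Q Y *\<^sub>R (R - Q)"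
      by (rule trans[OF bary_rep_edge[OF t'(1)]], simp add: f)+
    then have "X = Y" using eq by metis
    then show False using tri_neqD[OF tX] by simp
  qed
  have e: "{Y, X, Z} = {X, Y, Z}" by auto
  show ?thesis
  proof (cases "bary R P Q X < bary R P Q Y")
    case True then show ?thesis using * tX m f by blast
  next
    case False
    then have "bary R P Q Y < bary R P Q X" using ne by simp
    moreover have "tri Y X Z \<noteq> 0" using tX tri_perm(2)[of Y X Z] by simp
    ultimately show ?thesis using *[of Y X] m f unfolding e by blast
  qed
qed

lemma third_vertex:
  assumes tX: "tri X Y Z \<noteq> 0" and "V \<in> {X, Y, Z}" "W \<in> {X, Y, Z}" "V \<noteq> W"
  obtains U where "{X, Y, Z} = {V, W, U}" "tri V W U \<noteq> 0"
proof -
  have "\<exists>U. {X, Y, Z} = {V, W, U}" using assms(2-4) by blast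
  then obtain U where U: "{X, Y, Z} = {V, W, U}" by blast
  then have "\<not> collinear {V, W, U}" using tX collinear_iff_tri[of X Y Z] by simp
  then show ?thesis using that[OF U] collinear_iff_tri by simp
qed

theorem min_container_special:
  assumes tX: "tri X Y Z \<noteq> 0" and m: "min_isosceles_container (convex hull {X, Y, Z}) T'"
  shows "special {X, Y, Z} T'"
proof -
  obtain P Q R where t: "tri P Q R \<noteq> 0" and iso: "dist P Q = dist P R" and T': "T' = convex hull {P, Q, R}"
    using m by (auto simp: min_isosceles_container_def isosceles_container_iff)
  note m = m[unfolded T']
  have "iso3 P Q R" using iso by (simp add: iso3_def)
  from min_flush[OF t this tX m] obtain V W where VW: "V \<in> {X, Y, Z}" "W \<in> {X, Y, Z}" "V \<noteq> W"
    and f: "bary P Q R V = 0 \<and> bary P Q R W = 0 \<or> bary Q R P V = 0 \<and> bary Q R P W = 0 \<or>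
     bary R P Q V = 0 \<and> bary R P Q W = 0" by blast
  obtain U where U: "{X, Y, Z} = {V, W, U}" "tri V W U \<noteq> 0" by (rule third_vertex[OF tX VW])
  have e: "{P, R, Q} = {P, Q, R}" by auto
  have tR: "tri P R Q \<noteq> 0" using t tri_perm(1)[of P Q R] by simp
  note m = m[unfolded U(1)]
  from f show ?thesis unfolding T' U(1)
  proof (elim disjE conjE)
    assume "bary P Q R V = 0" "bary P Q R W = 0"
    then show "special {V, W, U} (convex hull {P, Q, R})" by (rule min_base_special[OF t iso U(2) m])
  next
    assume "bary R P Q V = 0" "bary R P Q W = 0"
    then show "special {V, W, U} (convex hull {P, Q, R})" by (rule min_leg_special[OF t iso U(2) m])
  next
    assume "bary Q R P V = 0" "bary Q R P W = 0"
    \<comment> \<open>The second leg is reduced to the first by exchanging \<open>Q\<close> and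
      \<open>R\<close>, which preserves \<open>dist P Q = dist P R\<close>.\<close>
    then have "bary Q P R V = 0" "bary Q P R W = 0" by (simp_all add: bary_swap)
    then show "special {V, W, U} (convex hull {P, Q, R})"
      using min_leg_special[OF tR iso[symmetric] U(2)] m unfolding e by blast
  qed
qed

section \<open>Existence of minimum containers; scalene triangles\<close>

text \<open>For each fixed \<open>n\<close> the inequality is a closed condition on
  \<open>(P, Q, R)\<close>. Containment thus becomes an intersection of closed conditions on the
  vertices, as the compactness argument needs.\<close>

lemma hull_mem_iff_inner:
  "V \<in> convex hull {P, Q, R} \<longleftrightarrow> (\<forall>n. min (n \<bullet> P) (min (n \<bullet> Q) (n \<bullet> R)) \<le> n \<bullet> (V::point))"
proof
  assume V: "V \<in> convex hull {P, Q, R}"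
  show "\<forall>n. min (n \<bullet> P) (min (n \<bullet> Q) (n \<bullet> R)) \<le> n \<bullet> V"
  proof
    fix n
    have "convex hull {P, Q, R} \<subseteq> {x. min (n \<bullet> P) (min (n \<bullet> Q) (n \<bullet> R)) \<le> n \<bullet> x}"
      by (intro hull_minimal convex_halfspace_ge) auto
    then show "min (n \<bullet> P) (min (n \<bullet> Q) (n \<bullet> R)) \<le> n \<bullet> V" using V by blast
  qed
next
  assume *: "\<forall>n. min (n \<bullet> P) (min (n \<bullet> Q) (n \<bullet> R)) \<le> n \<bullet> V"
  show "V \<in> convex hull {P, Q, R}"
  proof (rule ccontr)
    assume "V \<notin> convex hull {P, Q, R}"
    moreover have "closed (convex hull {P, Q, R})"
      by (intro compact_imp_closed finite_imp_compact_convex_hull) simp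
    ultimately obtain n b where "n \<bullet> V < b" "\<forall>x\<in>convex hull {P, Q, R}. b < n \<bullet> x"
      using separating_hyperplane_closed_point[OF convex_convex_hull] by blast
    moreover have "P \<in> convex hull {P, Q, R}" "Q \<in> convex hull {P, Q, R}" "R \<in> convex hull {P, Q, R}"
      by (auto intro: hull_inc)
    ultimately have "n \<bullet> V < n \<bullet> P" "n \<bullet> V < n \<bullet> Q" "n \<bullet> V < n \<bullet> R"
      by (meson order_less_trans)+
    then show False using *[rule_format, of n] by auto
  qed
qed

text \<open>Bounded area alone would allow long thin containers. But \<open>V\<close> spans, with
  any side of \<open>X Y Z\<close>, a triangle inside the container, so its barycentric coordinates
  with respect to \<open>X Y Z\<close> are bounded by the ratio of the areas.\<close>

lemma container_vertex_bounded:
  assumes t: "tri X Y Z \<noteq> 0" and sub: "{X, Y, Z} \<subseteq> convex hull {P, Q, R}"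
    and V: "V \<in> convex hull {P, Q, R}" and M: "\<bar>tri P Q R\<bar> \<le> M"
  shows "norm V \<le> M / \<bar>tri X Y Z\<bar> * (norm X + norm Y + norm Z)"
proof -
  have "\<bar>tri V A B\<bar> \<le> M" if "A \<in> {X, Y, Z}" "B \<in> {X, Y, Z}" for A B
    using that sub V M by (intro order_trans[OF area_mono M] hull_minimal convex_convex_hull) auto
  then have b: "\<bar>bary X Y Z V\<bar> \<le> M / \<bar>tri X Y Z\<bar>" "\<bar>bary Y Z X V\<bar> \<le> M / \<bar>tri X Y Z\<bar>"
    "\<bar>bary Z X Y V\<bar> \<le> M / \<bar>tri X Y Z\<bar>"
    unfolding bary_def abs_divide
    by (simp_all add: tri_perm(4)[of Z X Y] tri_perm(3)[of Y Z X] divide_right_mono)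
  have "norm V = norm (bary X Y Z V *\<^sub>R X + bary Y Z X V *\<^sub>R Y + bary Z X Y V *\<^sub>R Z)"
    by (rule arg_cong[OF bary_rep[OF t]])
  also have "\<dots> \<le> \<bar>bary X Y Z V\<bar> * norm X + \<bar>bary Y Z X V\<bar> * norm Y + \<bar>bary Z X Y V\<bar> * norm Z"
    by (intro norm_triangle_le add_mono) auto
  also have "\<dots> \<le> M / \<bar>tri X Y Z\<bar> * norm X + M / \<bar>tri X Y Z\<bar> * norm Y + M / \<bar>tri X Y Z\<bar> * norm Z"
    by (intro add_mono mult_right_mono b) auto
  finally show ?thesis by (simp only: distrib_left)
qed

lemma container_exists:
  assumes "tri X Y Z \<noteq> 0"
  shows "\<exists>T'. isosceles_container (convex hull {X, Y, Z}) T'"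
proof (cases "dist X Z \<le> dist X Y")
  case True then show ?thesis using leg_container(1)[OF assms] by blast
next
  case False
  have "tri X Z Y \<noteq> 0" "{X, Z, Y} = {X, Y, Z}" using assms tri_perm(1)[of X Y Z] by auto
  then show ?thesis using leg_container(1)[of X Z Y] False by auto
qed

lemma min_container_exists:
  assumes t: "tri X Y Z \<noteq> 0"
  shows "\<exists>T'. min_isosceles_container (convex hull {X, Y, Z}) T'"
proof -
  let ?S = "{X, Y, Z}"
  obtain P0 Q0 R0 where 0: "dist P0 Q0 = dist P0 R0" "convex hull ?S \<subseteq> convex hull {P0, Q0, R0}"
    using container_exists[OF t] by (auto simp: isosceles_container_iff)
  define M where "M = \<bar>tri P0 Q0 R0\<bar>"
  \<comment> \<open>Vertex triples of containers no larger than a known one. Non-degeneracy is not a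
    closed condition and is left out; it is recovered from the containment of \<open>T\<close>.
    Containers outside \<open>K\<close> exceed the area \<open>M\<close> and cannot compete.\<close>
  define K where "K = {x :: point \<times> point \<times> point. dist (fst x) (fst (snd x)) = dist (fst x) (snd (snd x))} \<inter>
    (\<Inter>n. \<Inter>V\<in>?S. {x. min (n \<bullet> fst x) (min (n \<bullet> fst (snd x)) (n \<bullet> snd (snd x))) \<le> n \<bullet> V}) \<inter>
    {x. \<bar>tri (fst x) (fst (snd x)) (snd (snd x))\<bar> \<le> M}"
  have K_iff: "(P, Q, R) \<in> K \<longleftrightarrow> dist P Q = dist P R \<and> ?S \<subseteq> convex hull {P, Q, R} \<and> \<bar>tri P Q R\<bar> \<le> M" for P Q R
    unfolding K_def by (auto simp: hull_mem_iff_inner)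
  have ct: "continuous_on UNIV (\<lambda>x :: point \<times> point \<times> point. \<bar>tri (fst x) (fst (snd x)) (snd (snd x))\<bar>)"
    unfolding tri_def by (intro continuous_intros)
  have "closed K"
    unfolding K_def
    by (intro closed_Int closed_INT ballI closed_Collect_eq closed_Collect_le ct) (intro continuous_intros)+
  moreover have "bounded K"
  proof -
    define N where "N = M / \<bar>tri X Y Z\<bar> * (norm X + norm Y + norm Z)"
    have "K \<subseteq> cball 0 N \<times> cball 0 N \<times> cball 0 N"
    proof
      fix x assume x: "x \<in> K"
      obtain P Q R where PQR: "x = (P, Q, R)" by (cases x)
      have *: "?S \<subseteq> convex hull {P, Q, R}" "\<bar>tri P Q R\<bar> \<le> M" using x K_iff PQR by auto
      have "norm V \<le> N" if "V \<in> {P, Q, R}" for V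
        unfolding N_def using that by (intro container_vertex_bounded[OF t *(1) hull_inc *(2)])
      then show "x \<in> cball 0 N \<times> cball 0 N \<times> cball 0 N" by (simp add: PQR)
    qed
    then show ?thesis by (rule bounded_subset[rotated]) (intro bounded_Times bounded_cball)
  qed
  ultimately have "compact K" by (simp add: compact_eq_bounded_closed)
  moreover have sub0: "?S \<subseteq> convex hull {P0, Q0, R0}" using 0(2) hull_subset[of ?S convex] by blast
  then have "(P0, Q0, R0) \<in> K" using 0 by (simp add: K_iff M_def)
  ultimately obtain z where z: "z \<in> K"
    "\<And>x. x \<in> K \<Longrightarrow> \<bar>tri (fst z) (fst (snd z)) (snd (snd z))\<bar> \<le> \<bar>tri (fst x) (fst (snd x)) (snd (snd x))\<bar>"
    using continuous_attains_inf[of K, OF _ _ continuous_on_subset[OF ct]] by blast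
  obtain P Q R where PQR: "z = (P, Q, R)" by (cases z)
  have z1: "dist P Q = dist P R" "?S \<subseteq> convex hull {P, Q, R}" "\<bar>tri P Q R\<bar> \<le> M"
    using z(1) by (auto simp: PQR K_iff)
  have sub: "convex hull ?S \<subseteq> convex hull {P, Q, R}" using z1(2) by (intro hull_minimal convex_convex_hull)
  then have "tri P Q R \<noteq> 0" using area_mono[OF sub] t by auto
  then have "isosceles_container (convex hull ?S) (convex hull {P, Q, R})"
    unfolding isosceles_container_iff using z1 sub by blast
  moreover have "area (convex hull {P, Q, R}) \<le> area T''" if c: "isosceles_container (convex hull ?S) T''" for T''
  proof -
    obtain P' Q' R' where T'': "T'' = convex hull {P', Q', R'}" "dist P' Q' = dist P' R'"
      "convex hull ?S \<subseteq> convex hull {P', Q', R'}"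
      using c by (auto simp: isosceles_container_iff)
    have "?S \<subseteq> convex hull {P', Q', R'}" using T''(3) hull_subset[of ?S convex] by blast
    then have "\<bar>tri P Q R\<bar> \<le> \<bar>tri P' Q' R'\<bar>"
      using z(2)[of "(P', Q', R')"] z1(3) T''(2) by (cases "\<bar>tri P' Q' R'\<bar> \<le> M") (auto simp: PQR K_iff)
    then show ?thesis by (simp add: T''(1) area_triangle)
  qed
  ultimately show ?thesis by (auto simp: min_isosceles_container_def)
qed

text \<open>The larger triangle is the closure of its interior, so any of its points outside the
  smaller, closed one yields a nonempty open set in the difference, which has positive
  measure.\<close>

lemma triangle_subset_area_eq:
  assumes t: "tri A B C \<noteq> 0" and sub: "convex hull {A, B, C} \<subseteq> convex hull {P, Q, R}"
    and le: "area (convex hull {P, Q, R}) \<le> area (convex hull {A, B, C})"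
  shows "convex hull {P, Q, R} = convex hull {A, B, C}"
proof (rule ccontr)
  let ?T = "convex hull {A, B, C}" and ?U = "convex hull {P, Q, R}"
  assume "?U \<noteq> ?T"
  then obtain x where x: "x \<in> ?U" "x \<notin> ?T" using sub by blast
  have c: "compact ?T" "compact ?U" by (simp_all add: finite_imp_compact_convex_hull)
  have "?U \<in> lmeasurable" "?T \<in> lmeasurable" using c by (simp_all add: lmeasurable_compact)
  have "0 < area ?T" using t by (simp add: area_triangle)
  then have "\<not> negligible ?T" by (auto simp: area_def negligible_imp_measure0)
  then have "\<not> negligible ?U" using sub negligible_subset by blast
  then have "interior ?U \<noteq> {}" using negligible_convex_interior[OF convex_convex_hull] by blast
  then have "closure (interior ?U) = ?U"
    using convex_closure_interior[OF convex_convex_hull, of "{P, Q, R}"] closure_closed[OF compact_imp_closed[OF c(2)]]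
    by simp
  then have "x \<in> closure (interior ?U)" using x by simp
  moreover have "open (- ?T)" using c(1) by (simp add: compact_imp_closed open_Compl)
  ultimately have "- ?T \<inter> interior ?U \<noteq> {}" using x(2) open_Int_closure_eq_empty[of "- ?T" "interior ?U"] by blast
  then have nn: "\<not> negligible (- ?T \<inter> interior ?U)"
    using \<open>open (- ?T)\<close> by (intro open_not_negligible open_Int) auto
  have W: "?U - ?T \<in> lmeasurable" using \<open>?U \<in> lmeasurable\<close> \<open>?T \<in> lmeasurable\<close> by (rule fmeasurable.Diff)
  have "- ?T \<inter> interior ?U \<subseteq> ?U - ?T" using interior_subset by blast
  then have "\<not> negligible (?U - ?T)" using nn negligible_subset by blast
  then have "measure lebesgue (?U - ?T) \<noteq> 0" using W negligible_iff_measure by blast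
  then have "0 < measure lebesgue (?U - ?T)" using measure_nonneg[of lebesgue] less_eq_real_def by metis
  moreover have "measure lebesgue (?U - ?T) = measure lebesgue ?U - measure lebesgue ?T"
    using \<open>?U \<in> lmeasurable\<close> \<open>?T \<in> lmeasurable\<close> sub by (rule measurable_measure_Diff[OF _ fmeasurableD])
  ultimately show False using le by (simp add: area_def)
qed

text \<open>This keeps isosceles triangles out of the classification of triangles with exactly three
  minimum containers.\<close>

lemma min_container_isosceles:
  assumes iso: "isosceles_triangle T" and m: "min_isosceles_container T T'"
  shows "T' = T"
proof -
  obtain A B C where T: "tri A B C \<noteq> 0" "T = convex hull {A, B, C}"
    using iso by (auto simp: isosceles_triangle_def collinear_iff_tri)
  have "isosceles_container T T" using iso by (simp add: isosceles_container_def)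
  then have "area T' \<le> area T" by (rule min_containerD[OF m])
  moreover obtain P Q R where "T' = convex hull {P, Q, R}" "T \<subseteq> T'"
    using m by (auto simp: min_isosceles_container_def isosceles_container_iff)
  ultimately show ?thesis using triangle_subset_area_eq[OF T(1)] T(2) by simp
qed

section \<open>Scalene triangles and their six special containers\<close>

locale scalene =
  fixes A B C :: point
  assumes tri: "tri A B C \<noteq> 0" and ab: "dist B C < dist A C" and bc: "dist A C < dist A B"
begin

lemma tri': "tri C A B \<noteq> 0" "tri B A C \<noteq> 0"
  using tri tri_perm(2)[of B A C] tri_perm(4)[of C A B] by auto

lemma pos: "0 < dist B C" "0 < dist A C" "0 < dist A B"
  using tri_neqD[OF tri] by auto

lemma hull_perm: "convex hull {C, A, B} = convex hull {A, B, C}" "convex hull {B, A, C} = convex hull {A, B, C}"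
  by (simp_all add: insert_commute)

lemma pt_C'_eq: "pt_C' A B C = leg_ext A B C"
  unfolding pt_C'_def
proof (rule the1_equality)
  show "\<exists>!P. P \<in> ray A C \<and> dist A P = dist A B"
    using special_points_ex1(2)[of A B C] tri ab bc by (simp add: collinear_iff_tri)
  have "dist A (leg_ext A B C) = dist A B / dist A C * dist A C"
    by (simp add: leg_ext_def dist_norm norm_minus_commute)
  then show "leg_ext A B C \<in> ray A C \<and> dist A (leg_ext A B C) = dist A B"
    using pos by (auto simp: ray_def leg_ext_def)
qed

lemma pt_B'_eq: "pt_B' A B C = leg_ext C A B"
  unfolding pt_B'_def
proof (rule the1_equality)
  show "\<exists>!P. P \<in> ray C B \<and> dist P C = dist A C"
    using special_points_ex1(1)[of A B C] tri ab bc by (simp add: collinear_iff_tri)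
  have "dist (leg_ext C A B) C = dist C A / dist C B * dist C B"
    by (simp add: leg_ext_def dist_norm norm_minus_commute)
  then show "leg_ext C A B \<in> ray C B \<and> dist (leg_ext C A B) C = dist A C"
    using pos by (auto simp: ray_def leg_ext_def dist_commute)
qed

lemma base_factor: "1 < 1 + ((dist C A)\<^sup>2 - (dist C B)\<^sup>2) / (dist A B)\<^sup>2"
proof -
  have "(dist C B)\<^sup>2 < (dist C A)\<^sup>2" using ab pos by (intro power_strict_mono) (auto simp: dist_commute)
  then show ?thesis using pos by simp
qed

lemma pt_B1_eq: "pt_B1 A B C = base_ext C A B"
  unfolding pt_B1_def
proof (rule the1_equality)
  show "\<exists>!P. P \<noteq> A \<and> P \<in> ray A B \<and> dist P C = dist A C"
    using special_points_ex1(4)[of A B C] tri ab bc by (simp add: collinear_iff_tri)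
  have ne: "A \<noteq> B" using pos by auto
  have "dist (base_ext C A B) C = dist A C" using dist_base_ext[OF ne, of C] by (simp add: dist_commute)
  moreover define s where "s = 1 + ((dist C A)\<^sup>2 - (dist C B)\<^sup>2) / (dist A B)\<^sup>2"
  have s: "1 < s" unfolding s_def by (rule base_factor)
  have "base_ext C A B = A + s *\<^sub>R (B - A)" by (simp add: base_ext_def s_def)
  then have "base_ext C A B \<noteq> A" "base_ext C A B \<in> ray A B" using s ne by (auto simp: ray_def)
  ultimately show "base_ext C A B \<noteq> A \<and> base_ext C A B \<in> ray A B \<and> dist (base_ext C A B) C = dist A C"
    by simp
qed

definition "a = dist B C"
definition "b = dist A C"
definition "c = dist A B"
definition "\<Delta> = area (convex hull {A, B, C})"

lemma abc: "0 < a" "a < b" "b < c" and \<Delta>: "0 < \<Delta>"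
  using pos ab bc tri by (auto simp: a_def b_def c_def \<Delta>_def area_triangle)

definition "T1 = leg_container C A B"
definition "T2 = leg_container A B C"
definition "T3 = base_container C A B"

lemma containers:
  "isosceles_container (convex hull {A, B, C}) T1" "area T1 = b / a * \<Delta>"
  "isosceles_container (convex hull {A, B, C}) T2" "area T2 = c / b * \<Delta>"
  "isosceles_container (convex hull {A, B, C}) T3" "area T3 = (1 + (b\<^sup>2 - a\<^sup>2) / c\<^sup>2) * \<Delta>"
  using leg_container[OF tri'(1)] leg_container[OF tri] base_container[OF tri'(1)] ab bc
  unfolding T1_def T2_def T3_def hull_perm a_def b_def c_def \<Delta>_def by (simp_all add: dist_commute)

lemma T_eq: "T1 = convex hull {A, pt_B' A B C, C}" "T2 = convex hull {A, B, pt_C' A B C}"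
  "T3 = convex hull {A, pt_B1 A B C, C}"
  by (simp_all add: T1_def T2_def T3_def leg_container_def base_container_def pt_B'_eq pt_C'_eq pt_B1_eq insert_commute)

lemma min_ratio_le:
  assumes m: "min_isosceles_container (convex hull {A, B, C}) T'"
    and c: "isosceles_container (convex hull {A, B, C}) T''"
    and ar: "area T' = r * \<Delta>" "area T'' = s * \<Delta>"
  shows "r \<le> s"
  using min_containerD[OF m c] \<Delta> unfolding ar by (simp only: mult_le_cancel_right_pos)

text \<open>The order of the sides leaves three admissible labellings, each with two kinds. Three of
  the six containers lose: c/a > c/b, 1 + (c^2 - b^2)/a^2 > c/b, and 1 + (c^2 - a^2)/b^2 > 1 + (b^2
  - a^2)/c^2.\<close>

lemma min_cases:
  assumes m: "min_isosceles_container (convex hull {A, B, C}) T'"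
  shows "T' \<in> {T1, T2, T3}"
proof -
  obtain X Y Z where XYZ: "{A, B, C} = {X, Y, Z}" and le: "dist X Z \<le> dist X Y"
    and T': "T' = leg_container X Y Z \<or> T' = base_container X Y Z"
    using min_container_special[OF tri m] by (auto simp: special_def)
  have ne: "A \<noteq> B" "A \<noteq> C" "B \<noteq> C" using tri_neqD[OF tri] by auto
  have "X = A \<and> Y = B \<and> Z = C \<or> X = A \<and> Y = C \<and> Z = B \<or> X = B \<and> Y = A \<and> Z = C \<or>
     X = B \<and> Y = C \<and> Z = A \<or> X = C \<and> Y = A \<and> Z = B \<or> X = C \<and> Y = B \<and> Z = A"
    using XYZ ne by (metis insert_iff singletonD)
  then have "X = A \<and> Y = B \<and> Z = C \<or> X = B \<and> Y = A \<and> Z = C \<or> X = C \<and> Y = A \<and> Z = B"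
    using le ab bc by (auto simp: dist_commute)
  moreover have "T' \<noteq> leg_container B A C"
  proof
    assume "T' = leg_container B A C"
    then have "area T' = c / a * \<Delta>"
      using leg_container(2)[OF tri'(2)] ab bc
      unfolding hull_perm a_def c_def \<Delta>_def by (simp add: dist_commute)
    then have "c / a \<le> c / b" by (rule min_ratio_le[OF m containers(3) _ containers(4)])
    moreover have "c / b < c / a" using abc by (simp add: frac_less2)
    ultimately show False by simp
  qed
  moreover have "T' \<noteq> base_container A B C"
  proof
    assume "T' = base_container A B C"
    then have "area T' = (1 + (c\<^sup>2 - b\<^sup>2) / a\<^sup>2) * \<Delta>"
      using base_container(2)[OF tri] bc unfolding a_def b_def c_def \<Delta>_def by simp
    then have le: "1 + (c\<^sup>2 - b\<^sup>2) / a\<^sup>2 \<le> c / b" by (rule min_ratio_le[OF m containers(3) _ containers(4)])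
    \<comment> \<open>Divided by b a^2 and multiplied by c - b, this becomes c/b - 1 < (c^2 -
      b^2)/a^2.\<close>
    have "a\<^sup>2 < b * (c + b)"
      using abc mult_strict_mono[of a b a b] by (simp add: power2_eq_square distrib_left add_strict_increasing)
    then have "1 / b < (c + b) / a\<^sup>2" using abc by (simp add: field_simps)
    then have "(c - b) * (1 / b) < (c - b) * ((c + b) / a\<^sup>2)" using abc by (intro mult_strict_left_mono) auto
    moreover have "(c - b) * (1 / b) = c / b - 1" using abc by (simp add: diff_divide_distrib)
    moreover have "(c - b) * (c + b) = c\<^sup>2 - b\<^sup>2" by (simp add: power2_eq_square algebra_simps)
    then have "(c - b) * ((c + b) / a\<^sup>2) = (c\<^sup>2 - b\<^sup>2) / a\<^sup>2" by simp
    ultimately show False using le by linarith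
  qed
  moreover have "T' \<noteq> base_container B A C"
  proof
    assume "T' = base_container B A C"
    then have "area T' = (1 + (c\<^sup>2 - a\<^sup>2) / b\<^sup>2) * \<Delta>"
      using base_container(2)[OF tri'(2)] ab bc
      unfolding hull_perm a_def b_def c_def \<Delta>_def by (simp add: dist_commute)
    then have "1 + (c\<^sup>2 - a\<^sup>2) / b\<^sup>2 \<le> 1 + (b\<^sup>2 - a\<^sup>2) / c\<^sup>2"
      by (rule min_ratio_le[OF m containers(5) _ containers(6)])
    then have le: "(c\<^sup>2 - a\<^sup>2) / b\<^sup>2 \<le> (b\<^sup>2 - a\<^sup>2) / c\<^sup>2" by simp
    have "b\<^sup>2 < c\<^sup>2" "a\<^sup>2 < b\<^sup>2" using abc by (auto intro: power_strict_mono)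
    moreover have "0 < a\<^sup>2" using abc by simp
    ultimately have "(b\<^sup>2 - a\<^sup>2) / c\<^sup>2 < (c\<^sup>2 - a\<^sup>2) / b\<^sup>2" by (intro frac_less) auto
    then show False using le by simp
  qed
  ultimately show ?thesis using T' by (auto simp: T1_def T2_def T3_def)
qed

lemma min_special_kinds:
  assumes "min_isosceles_container (convex hull {A, B, C}) T'"
  shows "T' \<in> special_first_kind A B C \<union> special_second_kind A B C"
  using min_cases[OF assms] by (auto simp: T_eq special_first_kind_def special_second_kind_def)

lemma min_subset: "{T'. min_isosceles_container (convex hull {A, B, C}) T'} \<subseteq> {T1, T2, T3}"
  using min_cases by blast

lemma finite_min: "finite {T'. min_isosceles_container (convex hull {A, B, C}) T'}"
  using min_subset by (rule finite_subset) simp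

lemma card_min: "card {T'. min_isosceles_container (convex hull {A, B, C}) T'} \<le> 3"
proof -
  have "card {T'. min_isosceles_container (convex hull {A, B, C}) T'} \<le> card {T1, T2, T3}"
    using min_subset by (intro card_mono) auto
  also have "\<dots> \<le> 3" by (simp add: card_insert_if)
  finally show ?thesis .
qed

end

section \<open>The critical angle\<close>

text \<open>Order 10 suffices: the arguments used later are below 0.74, where the remainder is less
  than 2e-8.\<close>

lemma sin_taylor_10:
  fixes x :: real
  shows "sin x \<le> x - x^3 / 6 + x^5 / 120 - x^7 / 5040 + x^9 / 362880 + \<bar>x\<bar>^10 / 3628800"
    and "x - x^3 / 6 + x^5 / 120 - x^7 / 5040 + x^9 / 362880 - \<bar>x\<bar>^10 / 3628800 \<le> sin x"
proof -
  obtain t where "sin x = (\<Sum>m<10. sin_coeff m * x ^ m) + (sin (t + 1/2 * real 10 * pi) / fact 10) * x ^ 10"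
    using Maclaurin_sin_expansion[of x 10] by blast
  moreover have "(\<Sum>m<10. sin_coeff m * x ^ m) = x - x^3 / 6 + x^5 / 120 - x^7 / 5040 + x^9 / 362880"
    by (simp add: sin_coeff_def lessThan_nat_numeral fact_numeral)
  moreover have "fact 10 = (3628800 :: real)" by (simp add: eval_nat_numeral)
  moreover define e where "e = (sin (t + 1/2 * real 10 * pi) / 3628800) * x ^ 10"
  ultimately have e: "sin x = x - x^3 / 6 + x^5 / 120 - x^7 / 5040 + x^9 / 362880 + e" by simp
  have "\<bar>e\<bar> = \<bar>sin (t + 1/2 * real 10 * pi)\<bar> * (\<bar>x\<bar>^10 / 3628800)"
    by (simp add: e_def abs_mult)
  also have "\<dots> \<le> 1 * (\<bar>x\<bar>^10 / 3628800)" by (intro mult_right_mono) auto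
  finally show "sin x \<le> x - x^3 / 6 + x^5 / 120 - x^7 / 5040 + x^9 / 362880 + \<bar>x\<bar>^10 / 3628800"
    "x - x^3 / 6 + x^5 / 120 - x^7 / 5040 + x^9 / 362880 - \<bar>x\<bar>^10 / 3628800 \<le> sin x" unfolding e by linarith+
qed

lemma cos_taylor_10:
  fixes x :: real
  shows "cos x \<le> 1 - x^2 / 2 + x^4 / 24 - x^6 / 720 + x^8 / 40320 + \<bar>x\<bar>^10 / 3628800"
    and "1 - x^2 / 2 + x^4 / 24 - x^6 / 720 + x^8 / 40320 - \<bar>x\<bar>^10 / 3628800 \<le> cos x"
proof -
  obtain t where "cos x = (\<Sum>m<10. cos_coeff m * x ^ m) + (cos (t + 1/2 * real 10 * pi) / fact 10) * x ^ 10"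
    using Maclaurin_cos_expansion[of x 10] by blast
  moreover have "(\<Sum>m<10. cos_coeff m * x ^ m) = 1 - x^2 / 2 + x^4 / 24 - x^6 / 720 + x^8 / 40320"
    by (simp add: cos_coeff_def lessThan_nat_numeral fact_numeral)
  moreover have "fact 10 = (3628800 :: real)" by (simp add: eval_nat_numeral)
  moreover define e where "e = (cos (t + 1/2 * real 10 * pi) / 3628800) * x ^ 10"
  ultimately have e: "cos x = 1 - x^2 / 2 + x^4 / 24 - x^6 / 720 + x^8 / 40320 + e" by simp
  have "\<bar>e\<bar> = \<bar>cos (t + 1/2 * real 10 * pi)\<bar> * (\<bar>x\<bar>^10 / 3628800)"
    by (simp add: e_def abs_mult)
  also have "\<dots> \<le> 1 * (\<bar>x\<bar>^10 / 3628800)" by (intro mult_right_mono) auto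
  finally show "cos x \<le> 1 - x^2 / 2 + x^4 / 24 - x^6 / 720 + x^8 / 40320 + \<bar>x\<bar>^10 / 3628800"
    "1 - x^2 / 2 + x^4 / 24 - x^6 / 720 + x^8 / 40320 - \<bar>x\<bar>^10 / 3628800 \<le> cos x" unfolding e by linarith+
qed

text \<open>Rational bounds for \<pi>/6 follow from the exact value sin (\<pi>/6) = 1/2 and
  monotonicity of the sine. The upper fraction is 355/113 divided by 6.\<close>

lemma pi_bounds: "6 * (4848/9259) < pi" "pi < 6 * (355/678)"
proof -
  have "sin (4848/9259) < sin (pi/6)"
    unfolding sin_30 by (rule le_less_trans[OF sin_taylor_10(1)]) (simp add: power_divide)
  then have "4848/9259 < pi/6"
    by (subst (asm) sin_mono_less_eq) (use pi_ge_two pi_less_4 in auto)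
  then show "6 * (4848/9259) < pi" by simp
  have "sin (pi/6) < sin (355/678)"
    unfolding sin_30 by (rule less_le_trans[OF _ sin_taylor_10(2)]) (simp add: power_divide)
  then have "pi/6 < 355/678"
    by (subst (asm) sin_mono_less_eq) (use pi_ge_two pi_less_4 in auto)
  then show "pi < 6 * (355/678)" by simp
qed

lemma quartic_mono:
  fixes p q :: real
  assumes "1 < p" "p < q"
  shows "p^4 - p < q^4 - q"
proof -
  have "1 < q^3" using assms by (intro one_less_power) auto
  moreover have "0 < q^2 * p + q * p^2 + p^3" using assms by (intro add_pos_pos) auto
  ultimately have "0 < q^3 + q^2 * p + q * p^2 + p^3 - 1" by linarith
  then have "0 < (q - p) * (q^3 + q^2 * p + q * p^2 + p^3 - 1)" using assms by simp
  also have "\<dots> = (q^4 - q) - (p^4 - p)" by (simp add: power2_eq_square power3_eq_cube power4_eq_xxxx algebra_simps)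
  finally show ?thesis by simp
qed

lemma quartic_root_unique:
  fixes p q :: real
  assumes "1 < p" "1 < q" "p^4 = p + 1" "q^4 = q + 1"
  shows "p = q"
  using quartic_mono[of p q] quartic_mono[of q p] assms by (cases p q rule: linorder_cases) auto

text \<open>The root is about 1.22074408. The endpoints are less than 1e-6 apart because this
  bracket limits the precision of the critical angle.\<close>

lemma quartic_root_exists: "\<exists>\<beta>::real. 4496/3683 < \<beta> \<and> \<beta> < 459/376 \<and> \<beta>^4 = \<beta> + 1"
proof -
  have "\<exists>x\<ge>4496/3683. x \<le> 459/376 \<and> x^4 - x = (1::real)"
    by (intro IVT' continuous_intros) (simp_all add: power_divide)
  then obtain x :: real where x: "4496/3683 \<le> x" "x \<le> 459/376" "x^4 - x = 1" by blast
  moreover have "(4496/3683::real)^4 - 4496/3683 \<noteq> 1" "(459/376::real)^4 - 459/376 \<noteq> 1"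
    by (simp_all add: power_divide)
  then have "x \<noteq> 4496/3683" "x \<noteq> 459/376" using x(3) by metis+
  ultimately show ?thesis by (intro exI[of _ x]) auto
qed

text \<open>The quotients sin 2\<alpha> / sin \<alpha> = 2 cos \<alpha> and sin 3\<alpha> / sin
  \<alpha> = 4 cos^2 \<alpha> - 1 are the side ratios c/a and b/a of the critical triangle; through
  them the equation becomes polynomial in the cosine.\<close>

lemma sin_identity:
  "sin \<alpha> * sin (2 * \<alpha>) - (sin (3 * \<alpha>))\<^sup>2 = (sin \<alpha>)\<^sup>2 * (2 * cos \<alpha> - (4 * (cos \<alpha>)\<^sup>2 - 1)\<^sup>2)"
  for \<alpha> :: real
proof -
  have "sin (3 * \<alpha>) = sin (2 * \<alpha> + \<alpha>)" by simp
  also have "\<dots> = sin \<alpha> * (4 * (cos \<alpha>)\<^sup>2 - 1)"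
    unfolding sin_add sin_double cos_double_cos by (simp add: power2_eq_square algebra_simps)
  finally have s3: "sin (3 * \<alpha>) = sin \<alpha> * (4 * (cos \<alpha>)\<^sup>2 - 1)" .
  show ?thesis unfolding s3 sin_double by (simp add: power2_eq_square algebra_simps)
qed

text \<open>Every solution in the interval has cos \<alpha> > 1/2, so q = 4 cos^2 \<alpha> - 1 is a
  root of the quartic above 1. That root is unique, and it determines the angle through q^2 = 2 cos
  \<alpha>.\<close>

lemma critical_angle:
  fixes \<beta> :: real
  assumes \<beta>: "4496/3683 < \<beta>" "\<beta> < 459/376" "\<beta>^4 = \<beta> + 1"
  defines "\<alpha>\<^sub>0 \<equiv> arccos (\<beta>\<^sup>2 / 2)"
  shows "cos \<alpha>\<^sub>0 = \<beta>\<^sup>2 / 2"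
    and "degrees 41.831252 < \<alpha>\<^sub>0" "\<alpha>\<^sub>0 < degrees 41.831652"
    and "{\<alpha> \<in> {degrees 36..degrees 45}. sin \<alpha> * sin (2 * \<alpha>) - (sin (3 * \<alpha>))\<^sup>2 = 0} = {\<alpha>\<^sub>0}"
proof -
  have b2: "(4496/3683)^2 < \<beta>^2" "\<beta>^2 < (459/376)^2" using \<beta>(1,2) by (intro power_strict_mono; simp)+
  then have C: "0.7 < \<beta>\<^sup>2 / 2" "\<beta>\<^sup>2 / 2 < 0.8" by (simp_all add: power_divide)
  show c0: "cos \<alpha>\<^sub>0 = \<beta>\<^sup>2 / 2" unfolding \<alpha>\<^sub>0_def using C by (intro cos_arccos) auto
  have r: "0 \<le> \<alpha>\<^sub>0" "\<alpha>\<^sub>0 \<le> pi" unfolding \<alpha>\<^sub>0_def using C by (simp_all add: arccos_lbound arccos_ubound)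
  \<comment> \<open>The rationals \<open>2559/3505\<close> and, below, \<open>1247/1708\<close>
    separate the angle from its two decimal bounds: their cosines are compared with the bracket of
    \<beta>, and they themselves with \<pi>.\<close>
  have "cos (2559/3505 :: real) < (4496/3683)^2 / 2"
    by (rule le_less_trans[OF cos_taylor_10(1)]) (simp add: power_divide)
  then have "cos (2559/3505) < cos \<alpha>\<^sub>0" using b2(1) unfolding c0 by linarith
  then have "\<alpha>\<^sub>0 < (2559/3505)"
    by (subst (asm) cos_mono_less_eq) (use r pi_bounds(1) in simp_all)
  also have "(2559/3505) < degrees 41.831652" using pi_bounds(1) by (simp add: degrees_def)
  finally show up: "\<alpha>\<^sub>0 < degrees 41.831652" .
  have "(459/376)^2 / 2 < cos (1247/1708 :: real)"
    by (rule less_le_trans[OF _ cos_taylor_10(2)]) (simp add: power_divide)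
  then have "cos \<alpha>\<^sub>0 < cos (1247/1708)" using b2(2) unfolding c0 by linarith
  then have "(1247/1708) < \<alpha>\<^sub>0"
    by (subst (asm) cos_mono_less_eq) (use r pi_bounds(1) in simp_all)
  moreover have "degrees 41.831252 < (1247/1708)" using pi_bounds(2) by (simp add: degrees_def)
  ultimately show lo: "degrees 41.831252 < \<alpha>\<^sub>0" by simp
  have d45: "degrees 45 = pi / 4" by (simp add: degrees_def)
  have in_range: "\<alpha>\<^sub>0 \<in> {degrees 36..degrees 45}"
    using lo up pi_gt_zero by (intro atLeastAtMost_iff[THEN iffD2] conjI) (simp_all add: degrees_def)
  have root: "2 * cos \<alpha>\<^sub>0 - (4 * (cos \<alpha>\<^sub>0)\<^sup>2 - 1)\<^sup>2 = 0"
  proof -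
    have "4 * (cos \<alpha>\<^sub>0)\<^sup>2 = \<beta>^4" unfolding c0 by (simp add: power_divide power_mult[symmetric])
    then show ?thesis unfolding c0 using \<beta>(3) by simp
  qed
  have uniq: "\<alpha> = \<alpha>\<^sub>0"
    if "\<alpha> \<in> {degrees 36..degrees 45}" "sin \<alpha> * sin (2 * \<alpha>) - (sin (3 * \<alpha>))\<^sup>2 = 0" for \<alpha>
  proof -
    have \<alpha>: "degrees 36 \<le> \<alpha>" "\<alpha> \<le> pi / 4" using that(1) d45 by simp_all
    have e: "(sin \<alpha>)\<^sup>2 * (2 * cos \<alpha> - (4 * (cos \<alpha>)\<^sup>2 - 1)\<^sup>2) = 0" using that(2) unfolding sin_identity .
    have p: "0 < \<alpha>" "\<alpha> < pi" using \<alpha> pi_gt_zero unfolding degrees_def by linarith+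
    then have "sin \<alpha> \<noteq> 0" using sin_gt_zero[of \<alpha>] by simp
    then have e: "2 * cos \<alpha> - (4 * (cos \<alpha>)\<^sup>2 - 1)\<^sup>2 = 0" using e by simp
    have c: "1/2 < cos \<alpha>"
    proof -
      have "cos (pi/3) < cos \<alpha>" using p \<alpha> pi_gt_zero by (intro cos_monotone_0_pi) auto
      then show ?thesis by (simp add: cos_60)
    qed
    define q where "q = 4 * (cos \<alpha>)\<^sup>2 - 1"
    have q2: "q\<^sup>2 = 2 * cos \<alpha>" using e unfolding q_def by linarith
    have q4: "q^4 = q + 1"
    proof -
      have "q^4 = (q\<^sup>2)\<^sup>2" by (simp add: power_mult[symmetric])
      also have "\<dots> = q + 1" unfolding q2 by (simp add: q_def power_mult_distrib)
      finally show ?thesis .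
    qed
    have "1 < q\<^sup>2" unfolding q2 using c by simp
    moreover have "0 < q"
    proof -
      have "(1/2)\<^sup>2 < (cos \<alpha>)\<^sup>2" using c by (intro power_strict_mono) auto
      then show ?thesis by (simp add: q_def power_divide)
    qed
    ultimately have "1 < q"
      by (intro power_less_imp_less_base[of 1 2 q]) (simp_all only: one_power2 less_imp_le)
    then have q\<beta>: "q = \<beta>" using quartic_root_unique[OF _ _ q4 \<beta>(3)] \<beta>(1) by simp
    have "cos \<alpha> = q\<^sup>2 / 2" unfolding q2 by simp
    then have "cos \<alpha> = cos \<alpha>\<^sub>0" unfolding q\<beta> c0 .
    then show ?thesis using p r cos_inj_pi[of \<alpha> \<alpha>\<^sub>0] less_imp_le by blast
  qed
  have "sin \<alpha>\<^sub>0 * sin (2 * \<alpha>\<^sub>0) - (sin (3 * \<alpha>\<^sub>0))\<^sup>2 = 0" unfolding sin_identity root by simp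
  then show "{\<alpha> \<in> {degrees 36..degrees 45}. sin \<alpha> * sin (2 * \<alpha>) - (sin (3 * \<alpha>))\<^sup>2 = 0} = {\<alpha>\<^sub>0}"
    using uniq in_range by blast
qed

section \<open>Triangles with three minimum containers\<close>

text \<open>The vertices are the extreme points of the hull; containers can therefore be told apart
  by their vertex sets.\<close>

lemma triangle_hull_vertices:
  assumes "tri P Q R \<noteq> 0" "tri X Y Z \<noteq> 0" "convex hull {P, Q, R} = convex hull {X, Y, Z}"
  shows "{P, Q, R} = {X, Y, Z}"
proof -
  have "\<not> affine_dependent {P, Q, R}" "\<not> affine_dependent {X, Y, Z}"
    using assms(1,2) affine_dependent_imp_collinear_3 collinear_iff_tri by blast+
  then show ?thesis
    using assms(3) extreme_point_of_convex_hull_affine_independent by (metis subsetI subset_antisym)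
qed

context scalene
begin

text \<open>\<open>B\<close> is a vertex of \<open>T2\<close> but lies strictly inside a side of
  \<open>T1\<close> and of \<open>T3\<close>. These two differ because \<open>B1\<close> lies on the
  line through \<open>A\<close> and \<open>B\<close> while \<open>B'\<close> does not.\<close>

lemma T_distinct: "T1 \<noteq> T2" "T1 \<noteq> T3" "T2 \<noteq> T3"
proof -
  note ne = tri_neqD[OF tri]
  define B' where "B' = leg_ext C A B"
  define C' where "C' = leg_ext A B C"
  define B1 where "B1 = base_ext C A B"
  define r s s' where "r = dist C A / dist C B" and "s = dist A B / dist A C"
    and "s' = 1 + ((dist C A)\<^sup>2 - (dist C B)\<^sup>2) / (dist A B)\<^sup>2"
  have rs: "1 < r" "1 < s" "1 < s'"
    using ab bc pos base_factor by (simp_all add: r_def s_def s'_def dist_commute)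
  have B': "B' = C + r *\<^sub>R (B - C)" and C': "C' = A + s *\<^sub>R (C - A)" and B1: "B1 = A + s' *\<^sub>R (B - A)"
    by (simp_all add: B'_def C'_def B1_def leg_ext_def base_ext_def r_def s_def s'_def)
  have t: "tri C A B' \<noteq> 0" "tri A B C' \<noteq> 0" "tri C A B1 \<noteq> 0"
    unfolding B' C' B1 tri_leg tri_base using rs tri tri' by simp_all
  have T: "T1 = convex hull {C, A, B'}" "T2 = convex hull {A, B, C'}" "T3 = convex hull {C, A, B1}"
    by (simp_all add: T1_def T2_def T3_def leg_container_def base_container_def B'_def C'_def B1_def)
  have "B - B' = (1 - r) *\<^sub>R (B - C)" "B - B1 = (1 - s') *\<^sub>R (B - A)"
    unfolding B' B1 by (simp_all add: algebra_simps)
  then have nB: "B \<noteq> B'" "B \<noteq> B1" using rs ne by auto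
  have B1C: "B1 \<noteq> C" "B1 \<noteq> A" using tri_neqD[OF t(3)] by auto
  have "tri A B B' = (1 - r) * tri A B C" unfolding B' by (simp add: tri_def algebra_simps)
  moreover have "tri A B B1 = 0" unfolding B1 by (simp add: tri_def algebra_simps)
  ultimately have "B' \<noteq> B1" using rs tri by auto
  show "T1 \<noteq> T2"
  proof
    assume "T1 = T2"
    then have "{C, A, B'} = {A, B, C'}" unfolding T by (rule triangle_hull_vertices[OF t(1,2)])
    then have "B \<in> {C, A, B'}" by blast
    then show False using nB ne by auto
  qed
  show "T2 \<noteq> T3"
  proof
    assume "T2 = T3"
    then have "{A, B, C'} = {C, A, B1}" unfolding T by (rule triangle_hull_vertices[OF t(2,3)])
    then have "B \<in> {C, A, B1}" by blast
    then show False using nB ne by auto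
  qed
  show "T1 \<noteq> T3"
  proof
    assume "T1 = T3"
    then have "{C, A, B'} = {C, A, B1}" unfolding T by (rule triangle_hull_vertices[OF t(1,3)])
    then have "B1 \<in> {C, A, B'}" by blast
    then show False using B1C \<open>B' \<noteq> B1\<close> by auto
  qed
qed

text \<open>Equal area ratios do not by themselves make the three candidates minimal. Some minimum
  exists, it is one of the three, and the others share its area.\<close>

lemma card_min_eq_3_iff:
  "card {T'. min_isosceles_container (convex hull {A, B, C}) T'} = 3 \<longleftrightarrow>
    b / a = c / b \<and> b / a = 1 + (b\<^sup>2 - a\<^sup>2) / c\<^sup>2"
proof
  let ?M = "{T'. min_isosceles_container (convex hull {A, B, C}) T'}"
  have c3: "card {T1, T2, T3} = 3" using T_distinct by simp
  {
    assume "card ?M = 3"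
    then have "?M = {T1, T2, T3}" using min_subset c3 by (intro card_subset_eq) auto
    then have m: "min_isosceles_container (convex hull {A, B, C}) T1"
      "min_isosceles_container (convex hull {A, B, C}) T2"
      "min_isosceles_container (convex hull {A, B, C}) T3" by blast+
    show "b / a = c / b \<and> b / a = 1 + (b\<^sup>2 - a\<^sup>2) / c\<^sup>2"
      using min_ratio_le[OF m(1) containers(3) containers(2,4)] min_ratio_le[OF m(2) containers(1) containers(4,2)]
        min_ratio_le[OF m(1) containers(5) containers(2,6)] min_ratio_le[OF m(3) containers(1) containers(6,2)]
      by linarith
  }
  assume eq: "b / a = c / b \<and> b / a = 1 + (b\<^sup>2 - a\<^sup>2) / c\<^sup>2"
  obtain T' where m: "min_isosceles_container (convex hull {A, B, C}) T'"
    using min_container_exists[OF tri] by blast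
  have ar: "area T = b / a * \<Delta>" if "T \<in> {T1, T2, T3}" for T
    using that containers(2,4,6) eq by auto
  have "min_isosceles_container (convex hull {A, B, C}) T" if "T \<in> {T1, T2, T3}" for T
    using m ar[OF that] ar[OF min_cases[OF m]] that containers(1,3,5)
    unfolding min_isosceles_container_def by auto
  then have "?M = {T1, T2, T3}" using min_subset by blast
  then show "card ?M = 3" using c3 by simp
qed

text \<open>With q = b/a the first equation is c = q^2 a. The second then reads q - 1 = (q - 1)(q +
  1)/q^4, and cancelling q - 1 > 0 leaves the quartic.\<close>

lemma card_min_eq_3_sides:
  assumes "1 < \<beta>" "\<beta>^4 = \<beta> + 1"
  shows "card {T'. min_isosceles_container (convex hull {A, B, C}) T'} = 3 \<longleftrightarrow> b = \<beta> * a \<and> c = \<beta>\<^sup>2 * a"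
proof -
  define q where "q = b / a"
  have q: "1 < q" and b: "b = q * a" using abc by (simp_all add: q_def)
  have ca: "b / a = c / b \<longleftrightarrow> c = q\<^sup>2 * a"
  proof -
    have "b \<noteq> 0" using abc by simp
    then have "q = c / b \<longleftrightarrow> q * b = c" by (rule nonzero_eq_divide_eq)
    moreover have "q * b = q\<^sup>2 * a" by (simp only: b power2_eq_square mult.assoc)
    ultimately show ?thesis unfolding q_def[symmetric] by auto
  qed
  have "b / a = 1 + (b\<^sup>2 - a\<^sup>2) / c\<^sup>2 \<longleftrightarrow> q^4 = q + 1" if c: "c = q\<^sup>2 * a"
  proof -
    have "(b\<^sup>2 - a\<^sup>2) / c\<^sup>2 = ((q - 1) * (q + 1) * a\<^sup>2) / (q^4 * a\<^sup>2)"
      unfolding b c by (simp add: power2_eq_square power4_eq_xxxx algebra_simps)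
    also have "\<dots> = (q - 1) * (q + 1) / q^4" using abc by simp
    finally have eq: "(b\<^sup>2 - a\<^sup>2) / c\<^sup>2 = (q - 1) * (q + 1) / q^4" .
    have "q^4 \<noteq> 0" using q by simp
    have "b / a = 1 + (b\<^sup>2 - a\<^sup>2) / c\<^sup>2 \<longleftrightarrow> q - 1 = (q - 1) * (q + 1) / q^4"
      unfolding eq q_def[symmetric] by linarith
    also have "\<dots> \<longleftrightarrow> (q - 1) * q^4 = (q - 1) * (q + 1)"
      using \<open>q^4 \<noteq> 0\<close> by (rule nonzero_eq_divide_eq)
    also have "\<dots> \<longleftrightarrow> q^4 = q + 1" using q by simp
    finally show ?thesis .
  qed
  then have "card {T'. min_isosceles_container (convex hull {A, B, C}) T'} = 3 \<longleftrightarrow> c = q\<^sup>2 * a \<and> q^4 = q + 1"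
    unfolding card_min_eq_3_iff ca by blast
  also have "q^4 = q + 1 \<longleftrightarrow> q = \<beta>" using quartic_root_unique[OF q assms(1)] assms(2) by blast
  also have "c = q\<^sup>2 * a \<and> q = \<beta> \<longleftrightarrow> b = \<beta> * a \<and> c = \<beta>\<^sup>2 * a"
  proof -
    have "a \<noteq> 0" using abc by simp
    then have "q = \<beta> \<longleftrightarrow> b = \<beta> * a" unfolding q_def by (rule nonzero_divide_eq_eq)
    then show ?thesis by metis
  qed
  finally show ?thesis .
qed

end

section \<open>Similarity and angles from side lengths\<close>

lemma bary_comb:
  assumes "tri P Q R \<noteq> 0" "u + v + w = 1"
  shows "bary P Q R (u *\<^sub>R P + v *\<^sub>R Q + w *\<^sub>R R) = u"
proof -
  have u: "u = 1 - v - w" using assms(2) by simp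
  have "tri (u *\<^sub>R P + v *\<^sub>R Q + w *\<^sub>R R) Q R = u * tri P Q R"
    unfolding u by (simp add: tri_def algebra_simps)
  then show ?thesis using assms(1) by (simp add: bary_def)
qed

text \<open>A displacement whose barycentric coordinates sum to 0 has a length that depends on these
  coordinates and the side lengths alone.\<close>

lemma norm2_comb:
  fixes P Q R :: point
  assumes "u + v + w = 0"
  shows "(norm (u *\<^sub>R P + v *\<^sub>R Q + w *\<^sub>R R))\<^sup>2 =
    - (u * v * (dist P Q)\<^sup>2 + u * w * (dist P R)\<^sup>2 + v * w * (dist Q R)\<^sup>2)"
proof -
  have u: "u = - v - w" using assms by simp
  show ?thesis unfolding dist2_eq power2_norm_eq_inner inner_vec2 u
    by (simp add: power2_eq_square algebra_simps)
qed

text \<open>The affine map sending vertex to vertex keeps barycentric coordinates, so by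
  \<open>norm2_comb\<close> it multiplies every distance by \<open>r\<close>. This covers both
  orientations.\<close>

lemma similar_SSS:
  fixes A B C A' B' C' :: point
  assumes t: "tri A B C \<noteq> 0" and r: "0 < r"
    and d: "dist A' B' = r * dist A B" "dist A' C' = r * dist A C" "dist B' C' = r * dist B C"
  shows "similar (convex hull {A, B, C}) (convex hull {A', B', C'})"
proof -
  define f where "f x = bary A B C x *\<^sub>R A' + bary B C A x *\<^sub>R B' + bary C A B x *\<^sub>R C'" for x
  have t': "tri B C A \<noteq> 0" "tri C A B \<noteq> 0" using t tri_perm(3)[of B C A] tri_perm(4)[of C A B] by simp_all
  have "dist (f x) (f y) = r * dist x y" for x y
  proof -
    define u v w where "u = bary A B C x - bary A B C y" and "v = bary B C A x - bary B C A y"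
      and "w = bary C A B x - bary C A B y"
    have 0: "u + v + w = 0" using bary_sum[OF t, of x] bary_sum[OF t, of y] by (simp add: u_def v_def w_def)
    have "x - y = (bary A B C x *\<^sub>R A + bary B C A x *\<^sub>R B + bary C A B x *\<^sub>R C) -
       (bary A B C y *\<^sub>R A + bary B C A y *\<^sub>R B + bary C A B y *\<^sub>R C)"
      by (rule arg_cong2[OF bary_rep[OF t] bary_rep[OF t]])
    also have "\<dots> = u *\<^sub>R A + v *\<^sub>R B + w *\<^sub>R C" by (simp add: u_def v_def w_def algebra_simps)
    finally have xy: "x - y = u *\<^sub>R A + v *\<^sub>R B + w *\<^sub>R C" .
    have fxy: "f x - f y = u *\<^sub>R A' + v *\<^sub>R B' + w *\<^sub>R C'" by (simp add: f_def u_def v_def w_def algebra_simps)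
    have "(dist (f x) (f y))\<^sup>2 = (r * dist x y)\<^sup>2"
      unfolding dist_norm[of "f x"] dist_norm[of x] power_mult_distrib xy fxy norm2_comb[OF 0] d
      by (simp add: algebra_simps)
    then show ?thesis using r by (simp add: power2_eq_iff_nonneg)
  qed
  moreover have fc: "f (u *\<^sub>R A + v *\<^sub>R B + w *\<^sub>R C) = u *\<^sub>R A' + v *\<^sub>R B' + w *\<^sub>R C'" if "u + v + w = 1" for u v w
  proof -
    have "bary B C A (u *\<^sub>R A + v *\<^sub>R B + w *\<^sub>R C) = v"
      using bary_comb[OF t'(1), of v w u] that by (simp add: add_ac)
    moreover have "bary C A B (u *\<^sub>R A + v *\<^sub>R B + w *\<^sub>R C) = w"
      using bary_comb[OF t'(2), of w u v] that by (simp add: add_ac)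
    ultimately show ?thesis using bary_comb[OF t that] by (simp add: f_def)
  qed
  have "f ` (convex hull {A, B, C}) = convex hull {A', B', C'}"
  proof (intro equalityI subsetI)
    fix x assume "x \<in> f ` (convex hull {A, B, C})"
    then obtain u v w where "0 \<le> u" "0 \<le> v" "0 \<le> w" "u + v + w = 1" "x = f (u *\<^sub>R A + v *\<^sub>R B + w *\<^sub>R C)"
      by (auto simp: convex_hull_3)
    then show "x \<in> convex hull {A', B', C'}" using fc by (intro in_hull_3I[of u v w]) auto
  next
    fix x assume "x \<in> convex hull {A', B', C'}"
    then obtain u v w where *: "0 \<le> u" "0 \<le> v" "0 \<le> w" "u + v + w = 1" "x = u *\<^sub>R A' + v *\<^sub>R B' + w *\<^sub>R C'"
      by (auto simp: convex_hull_3)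
    then have "x = f (u *\<^sub>R A + v *\<^sub>R B + w *\<^sub>R C)" using fc by simp
    moreover have "u *\<^sub>R A + v *\<^sub>R B + w *\<^sub>R C \<in> convex hull {A, B, C}" using * by (intro in_hull_3I) auto
    ultimately show "x \<in> f ` (convex hull {A, B, C})" by blast
  qed
  ultimately show ?thesis using r unfolding similar_def by blast
qed

lemma scalene_labelling:
  assumes "tri X Y Z \<noteq> 0" "dist X Y \<noteq> dist X Z" "dist Y X \<noteq> dist Y Z" "dist Z X \<noteq> dist Z Y"
  obtains A B C where "scalene A B C" "{X, Y, Z} = {A, B, C}"
proof -
  have t: "tri X Z Y \<noteq> 0" "tri Y X Z \<noteq> 0" "tri Y Z X \<noteq> 0" "tri Z X Y \<noteq> 0" "tri Z Y X \<noteq> 0"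
    using assms(1) by (simp_all add: tri_def algebra_simps)
  define p q r where "p = dist X Y" and "q = dist X Z" and "r = dist Y Z"
  have "p \<noteq> q" "p \<noteq> r" "q \<noteq> r" using assms(2-4) by (simp_all add: p_def q_def r_def dist_commute)
  then consider "r < q \<and> q < p" | "r < p \<and> p < q" | "q < r \<and> r < p" | "q < p \<and> p < r" | "p < r \<and> r < q" | "p < q \<and> q < r"
    by (meson linorder_less_linear)
  then show ?thesis
  proof cases
    case 1
    then have "scalene X Y Z" using assms(1) t unfolding scalene_def p_def q_def r_def by (simp add: dist_commute)
    then show ?thesis by (rule that) auto
  next
    case 2
    then have "scalene X Z Y" using assms(1) t unfolding scalene_def p_def q_def r_def by (simp add: dist_commute)
    then show ?thesis by (rule that) auto
  next
    case 3
    then have "scalene Y X Z" using assms(1) t unfolding scalene_def p_def q_def r_def by (simp add: dist_commute)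
    then show ?thesis by (rule that) auto
  next
    case 4
    then have "scalene Y Z X" using assms(1) t unfolding scalene_def p_def q_def r_def by (simp add: dist_commute)
    then show ?thesis by (rule that) auto
  next
    case 5
    then have "scalene Z X Y" using assms(1) t unfolding scalene_def p_def q_def r_def by (simp add: dist_commute)
    then show ?thesis by (rule that) auto
  next
    case 6
    then have "scalene Z Y X" using assms(1) t unfolding scalene_def p_def q_def r_def by (simp add: dist_commute)
    then show ?thesis by (rule that) auto
  qed
qed

lemma angle_at_cos:
  assumes "X \<noteq> Y" "Z \<noteq> Y" "0 \<le> \<theta>" "\<theta> \<le> pi"
    and "(dist X Y)\<^sup>2 + (dist Z Y)\<^sup>2 - (dist X Z)\<^sup>2 = 2 * (dist X Y * dist Z Y) * cos \<theta>"
  shows "angle_at X Y Z = \<theta>"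
proof -
  have "(X - Y) \<bullet> (Z - Y) = ((dist X Y)\<^sup>2 + (dist Z Y)\<^sup>2 - (dist X Z)\<^sup>2) / 2"
    unfolding dist2_eq inner_vec2 by (simp add: power2_eq_square algebra_simps)
  also have "\<dots> = dist X Y * dist Z Y * cos \<theta>" using assms(5) by simp
  finally have "(X - Y) \<bullet> (Z - Y) / (norm (X - Y) * norm (Z - Y)) = cos \<theta>"
    using assms(1,2) by (simp add: dist_norm)
  then show ?thesis unfolding angle_at_def using assms(3,4) by (simp add: arccos_cos)
qed

text \<open>\<open>A\<close> is the origin and \<open>B\<close> lies on the first axis, so the angle
  at \<open>A\<close> and two sides are built in; the third side and the other angles follow from
  the quartic.\<close>

lemma critical_triangle:
  fixes \<beta> :: real
  assumes \<beta>: "4496/3683 < \<beta>" "\<beta> < 459/376" "\<beta>^4 = \<beta> + 1"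
  defines "\<alpha>\<^sub>0 \<equiv> arccos (\<beta>\<^sup>2 / 2)"
  obtains A B C where "scalene A B C" "dist B C = 1" "dist A C = \<beta>" "dist A B = \<beta>\<^sup>2"
    "has_angles (convex hull {A, B, C}) \<alpha>\<^sub>0 (2 * \<alpha>\<^sub>0) (degrees 180 - 3 * \<alpha>\<^sub>0)"
proof -
  note crit = critical_angle[OF \<beta>, folded \<alpha>\<^sub>0_def]
  note c0 = crit(1)
  have \<alpha>: "0 < \<alpha>\<^sub>0" "\<alpha>\<^sub>0 < pi / 4"
    using crit(2,3) pi_gt_zero by (auto simp: degrees_def)
  have s0: "0 < sin \<alpha>\<^sub>0" using \<alpha> pi_gt_zero by (intro sin_gt_zero) auto
  define A B C :: point where "A = 0" and "B = vector [\<beta>\<^sup>2, 0]" and "C = vector [\<beta> * cos \<alpha>\<^sub>0, \<beta> * sin \<alpha>\<^sub>0]"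
  have comp: "A$1 = 0" "A$2 = 0" "B$1 = \<beta>\<^sup>2" "B$2 = 0" "C$1 = \<beta> * cos \<alpha>\<^sub>0" "C$2 = \<beta> * sin \<alpha>\<^sub>0"
    by (simp_all add: A_def B_def C_def)
  have b4: "\<beta> * \<beta> * \<beta> * \<beta> = \<beta> + 1" using \<beta>(3) by (simp add: power4_eq_xxxx)
  have "(dist A B)\<^sup>2 = (\<beta>\<^sup>2)\<^sup>2" unfolding dist2_eq comp by simp
  then have AB: "dist A B = \<beta>\<^sup>2" by (rule power2_eq_imp_eq) simp_all
  have cs: "(cos \<alpha>\<^sub>0)\<^sup>2 + (sin \<alpha>\<^sub>0)\<^sup>2 = 1" by simp
  have "(dist A C)\<^sup>2 = \<beta>\<^sup>2" unfolding dist2_eq comp using cs by algebra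
  then have AC: "dist A C = \<beta>" by (rule power2_eq_imp_eq) (use \<beta>(1) in simp_all)
  have "(dist B C)\<^sup>2 = 1\<^sup>2"
  proof -
    have "(dist B C)\<^sup>2 = \<beta>^4 - 2 * \<beta>^3 * cos \<alpha>\<^sub>0 + \<beta>\<^sup>2"
      unfolding dist2_eq comp using cs by algebra
    \<comment> \<open>Since 2 cos \<open>\<alpha>\<^sub>0\<close> = \<beta>^2, the middle term is
      \<beta> times \<beta>^4; the quartic then turns the sum into (1 + \<beta>)(1 - \<beta>) +
      \<beta>^2 = 1.\<close>
    also have "\<dots> = \<beta>^4 - \<beta> * \<beta>^4 + \<beta>\<^sup>2"
      unfolding c0 by (simp add: power2_eq_square power3_eq_cube power4_eq_xxxx)
    also have "\<dots> = 1\<^sup>2" unfolding \<beta>(3) by (simp add: power2_eq_square algebra_simps)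
    finally show ?thesis .
  qed
  then have BC: "dist B C = 1" by (rule power2_eq_imp_eq) simp_all
  have t: "tri A B C \<noteq> 0" unfolding tri_def comp using \<beta>(1) s0 by simp
  have "1 < \<beta>" using \<beta>(1) by simp
  then have "\<beta> * 1 < \<beta> * \<beta>" by (intro mult_strict_left_mono) auto
  then have sc: "scalene A B C" using t \<open>1 < \<beta>\<close> unfolding scalene_def AB AC BC by (simp add: power2_eq_square)
  note ne = tri_neqD[OF t]
  have "has_angles (convex hull {A, B, C}) \<alpha>\<^sub>0 (2 * \<alpha>\<^sub>0) (degrees 180 - 3 * \<alpha>\<^sub>0)"
    unfolding has_angles_def
  proof (intro exI conjI)
    \<comment> \<open>The vertices are taken in the order \<open>A\<close>, \<open>C\<close>,
      \<open>B\<close>, as the doubled angle sits at \<open>C\<close>, opposite the longest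
      side.\<close>
    show "\<not> collinear {A, C, B}" using t tri_perm(1)[of A C B] by (simp add: collinear_iff_tri)
    show "convex hull {A, B, C} = convex hull {A, C, B}" by (simp add: insert_commute)
    show "angle_at C A B = \<alpha>\<^sub>0"
    proof (rule angle_at_cos)
      show "(dist C A)\<^sup>2 + (dist B A)\<^sup>2 - (dist C B)\<^sup>2 = 2 * (dist C A * dist B A) * cos \<alpha>\<^sub>0"
        unfolding dist_commute[of C] dist_commute[of B A] AB AC BC c0 using b4
        by (simp add: power2_eq_square algebra_simps)
    qed (use ne \<alpha> pi_gt_zero in auto)
    show "angle_at A C B = 2 * \<alpha>\<^sub>0"
    proof (rule angle_at_cos)
      show "(dist A C)\<^sup>2 + (dist B C)\<^sup>2 - (dist A B)\<^sup>2 = 2 * (dist A C * dist B C) * cos (2 * \<alpha>\<^sub>0)"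
        unfolding AB AC BC cos_double_cos c0 using b4
        by (simp add: power2_eq_square algebra_simps)
    qed (use ne \<alpha> pi_gt_zero in auto)
    have d: "degrees 180 = pi" by (simp add: degrees_def)
    show "angle_at A B C = degrees 180 - 3 * \<alpha>\<^sub>0"
      unfolding d
    proof (rule angle_at_cos)
      have "cos (pi - 3 * \<alpha>\<^sub>0) = 3 * cos \<alpha>\<^sub>0 - 4 * cos \<alpha>\<^sub>0 ^ 3" by (simp add: cos_diff cos_treble_cos)
      also have "\<dots> = \<beta>\<^sup>2 / 2 * (3 - \<beta>^4)" unfolding c0 by (simp add: power2_eq_square power3_eq_cube power4_eq_xxxx algebra_simps)
      also have "\<dots> = \<beta>\<^sup>2 / 2 * (2 - \<beta>)" unfolding \<beta>(3) by simp
      finally have c3: "cos (pi - 3 * \<alpha>\<^sub>0) = \<beta>\<^sup>2 / 2 * (2 - \<beta>)" .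
      have "(dist A B)\<^sup>2 + (dist C B)\<^sup>2 - (dist A C)\<^sup>2 = \<beta>^4 + 1 - \<beta>\<^sup>2"
        unfolding dist_commute[of C B] AB AC BC by (simp add: power_mult[symmetric])
      also have "\<dots> = \<beta>^4 * (2 - \<beta>)" unfolding \<beta>(3) by (simp add: power2_eq_square algebra_simps)
      also have "\<dots> = 2 * (dist A B * dist C B) * cos (pi - 3 * \<alpha>\<^sub>0)"
        unfolding dist_commute[of C B] AB BC c3 by (simp add: power2_eq_square power4_eq_xxxx)
      finally show "(dist A B)\<^sup>2 + (dist C B)\<^sup>2 - (dist A C)\<^sup>2 = 2 * (dist A B * dist C B) * cos (pi - 3 * \<alpha>\<^sub>0)" .
    qed (use ne \<alpha> pi_gt_zero in auto)
  qed
  then show ?thesis using that sc AB AC BC by blast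
qed

text \<open>An isosceles triangle has at most one minimum container, namely itself, so a count of 3
  forces distinct side lengths.\<close>

lemma card_3_scalene:
  assumes T: "is_triangle T" and c: "card {T'. min_isosceles_container T T'} = 3"
  obtains A B C where "scalene A B C" "T = convex hull {A, B, C}"
proof -
  obtain X Y Z where t: "tri X Y Z \<noteq> 0" and T: "T = convex hull {X, Y, Z}"
    using T by (auto simp: is_triangle_def collinear_iff_tri)
  have "\<not> isosceles_triangle T"
  proof
    assume "isosceles_triangle T"
    then have "{T'. min_isosceles_container T T'} \<subseteq> {T}" using min_container_isosceles by blast
    then have "card {T'. min_isosceles_container T T'} \<le> card {T}" by (intro card_mono) auto
    then show False using c by simp
  qed
  then have "\<not> isosceles_container T T" by (simp add: isosceles_container_def)
  then have "\<not> iso3 X Y Z" using iso3_container[OF t] T by blast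
  then obtain A B C where "scalene A B C" "{X, Y, Z} = {A, B, C}"
    using scalene_labelling[OF t] by (auto simp: iso3_def)
  then show ?thesis using that T by simp
qed

theorem theorem1p6:
  shows
    "(\<forall>A B C :: point.
        \<not> collinear {A, B, C} \<and> dist B C < dist A C \<and> dist A C < dist A B \<longrightarrow>
          finite {T'. min_isosceles_container (convex hull {A, B, C}) T'} \<and>
          card {T'. min_isosceles_container (convex hull {A, B, C}) T'} \<le> 3 \<and>
          (\<forall>T'. min_isosceles_container (convex hull {A, B, C}) T' \<longrightarrow>
             T' \<in> {convex hull {A, pt_B' A B C, C},
                   convex hull {A, B, pt_C' A B C},
                   convex hull {A, pt_B1 A B C, C}}) \<and>
          (\<forall>T'. min_isosceles_container (convex hull {A, B, C}) T' \<longrightarrow>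
             T' \<in> special_first_kind A B C \<union> special_second_kind A B C))
     \<and>
     (\<exists>\<alpha>\<^sub>0 T\<^sub>0.
        {\<alpha> \<in> {degrees 36..degrees 45}. sin \<alpha> * sin (2 * \<alpha>) - (sin (3 * \<alpha>))\<^sup>2 = 0} = {\<alpha>\<^sub>0} \<and>
        \<bar>\<alpha>\<^sub>0 - degrees 41.831452\<bar> < degrees 0.0002 \<and>
        is_triangle T\<^sub>0 \<and>
        card {T'. min_isosceles_container T\<^sub>0 T'} = 3 \<and>
        has_angles T\<^sub>0 \<alpha>\<^sub>0 (2 * \<alpha>\<^sub>0) (degrees 180 - 3 * \<alpha>\<^sub>0) \<and>
        (\<forall>T. is_triangle T \<and> card {T'. min_isosceles_container T T'} = 3 \<longrightarrow> similar T\<^sub>0 T))"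
proof (rule conjI, intro allI impI)
  fix A B C :: point
  assume "\<not> collinear {A, B, C} \<and> dist B C < dist A C \<and> dist A C < dist A B"
  then interpret scalene A B C by unfold_locales (auto simp: collinear_iff_tri)
  show "finite {T'. min_isosceles_container (convex hull {A, B, C}) T'} \<and>
      card {T'. min_isosceles_container (convex hull {A, B, C}) T'} \<le> 3 \<and>
      (\<forall>T'. min_isosceles_container (convex hull {A, B, C}) T' \<longrightarrow>
         T' \<in> {convex hull {A, pt_B' A B C, C}, convex hull {A, B, pt_C' A B C},
               convex hull {A, pt_B1 A B C, C}}) \<and>
      (\<forall>T'. min_isosceles_container (convex hull {A, B, C}) T' \<longrightarrow>
         T' \<in> special_first_kind A B C \<union> special_second_kind A B C)"
    using finite_min card_min min_cases[unfolded T_eq] min_special_kinds by blast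
next
  obtain \<beta> :: real where \<beta>: "4496/3683 < \<beta>" "\<beta> < 459/376" "\<beta>^4 = \<beta> + 1"
    using quartic_root_exists by blast
  define \<alpha>\<^sub>0 where "\<alpha>\<^sub>0 = arccos (\<beta>\<^sup>2 / 2)"
  note crit = critical_angle[OF \<beta>, folded \<alpha>\<^sub>0_def]
  obtain A B C where sc: "scalene A B C" and sides: "dist B C = 1" "dist A C = \<beta>" "dist A B = \<beta>\<^sup>2"
    and ang: "has_angles (convex hull {A, B, C}) \<alpha>\<^sub>0 (2 * \<alpha>\<^sub>0) (degrees 180 - 3 * \<alpha>\<^sub>0)"
    using critical_triangle[OF \<beta>, folded \<alpha>\<^sub>0_def] by blast
  interpret T0: scalene A B C by (rule sc)
  have \<beta>1: "1 < \<beta>" using \<beta> by simp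
  have "is_triangle (convex hull {A, B, C})"
    unfolding is_triangle_def using T0.tri collinear_iff_tri by blast
  moreover have "card {T'. min_isosceles_container (convex hull {A, B, C}) T'} = 3"
    unfolding T0.card_min_eq_3_sides[OF \<beta>1 \<beta>(3)] T0.a_def T0.b_def T0.c_def by (simp add: sides)
  moreover have "similar (convex hull {A, B, C}) T"
    if T: "is_triangle T" "card {T'. min_isosceles_container T T'} = 3" for T
  proof -
    obtain X Y Z where sc: "scalene X Y Z" and T': "T = convex hull {X, Y, Z}"
      using card_3_scalene[OF T] by blast
    interpret S: scalene X Y Z by (rule sc)
    have "dist X Z = \<beta> * dist Y Z" "dist X Y = \<beta>\<^sup>2 * dist Y Z"
      using T(2) S.card_min_eq_3_sides[OF \<beta>1 \<beta>(3)] unfolding T' S.a_def S.b_def S.c_def by auto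
    then show ?thesis
      unfolding T' by (intro similar_SSS[OF T0.tri S.pos(1)]) (simp_all add: sides)
  qed
  \<comment> \<open>The bounds 41.831252 and 41.831652 from \<open>critical_angle\<close> are
    41.831452 minus and plus 0.0002.\<close>
  moreover have "\<bar>\<alpha>\<^sub>0 - degrees 41.831452\<bar> < degrees 0.0002"
    unfolding abs_diff_less_iff using crit(2,3) by (simp add: degrees_def)
  ultimately show "\<exists>\<alpha>\<^sub>0 T\<^sub>0.
        {\<alpha> \<in> {degrees 36..degrees 45}. sin \<alpha> * sin (2 * \<alpha>) - (sin (3 * \<alpha>))\<^sup>2 = 0} = {\<alpha>\<^sub>0} \<and>
        \<bar>\<alpha>\<^sub>0 - degrees 41.831452\<bar> < degrees 0.0002 \<and>
        is_triangle T\<^sub>0 \<and>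
        card {T'. min_isosceles_container T\<^sub>0 T'} = 3 \<and>
        has_angles T\<^sub>0 \<alpha>\<^sub>0 (2 * \<alpha>\<^sub>0) (degrees 180 - 3 * \<alpha>\<^sub>0) \<and>
        (\<forall>T. is_triangle T \<and> card {T'. min_isosceles_container T T'} = 3 \<longrightarrow> similar T\<^sub>0 T)"
    using crit(4) ang by blast
qed

end
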